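(* Let $K$ be a field and let $I(n,p)\subset K[x_1,\ldots,x_n]$ be the edge ideal of the Erd\H{o}s--R\'enyi random graph $G(n,p)$. Then: (1) If $p=n^{-\alpha}$ with $\alpha\in(\tfrac32,2)$, then $I(n,p)$ is unmixed with high probability. (2) If $p=n^{-\alpha}$ with $\alpha\in[1,\tfrac32)$, then $I(n,p)$ is not unmixed with high probability. (3) If $p\in(0,1)$ is a fixed constant, then $I(n,p)$ is not unmixed with high probability. (4) If $p=1-n^{-\alpha}$ with $\alpha\in(0,2)$ and $\alpha^{-1}\notin\{2,3,\ldots\}$, then $I(n,p)$ is not unmixed with high probability. (5) If $p=1-n^{-\alpha}$ with $\alpha>2$, then $I(n,p)$ is unmixed with high probability.
   Context: $G(n,p)$ has vertex set $[n]$ with each pair an edge independently with probability $p$; the edge ideal of $G$ is $I(G)=(x_ix_j:\{i,j\}\in E(G))$ and $I(n,p)=I(G(n,p))$. An ideal is unmixed if all its associated primes are minimal of the same height; for an edge ideal this means all minimal vertex covers of the graph have the same size. "With high probability" means with probability tending to $1$ as $n\to\infty$. *)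

theory Defs
  imports
    "HOL-Probability.Probability"
    "HOL-Algebra.Ideal"
    "HOL-Library.Poly_Mapping"
    "HOL-Library.Extended_Nat"
begin

section \<open>Unmixed ideals\<close>

definition minimal_primes :: "('a, 'b) ring_scheme \<Rightarrow> 'a set \<Rightarrow> 'a set set" where
  "minimal_primes R I =
     {P. primeideal P R \<and> I \<subseteq> P \<and> (\<forall>Q. primeideal Q R \<and> I \<subseteq> Q \<and> Q \<subseteq> P \<longrightarrow> Q = P)}"

text \<open>The colon ideal \<open>I : f\<close> is the annihilator of the class of \<open>f\<close> in \<open>R/I\<close>.\<close>

definition associated_primes :: "('a, 'b) ring_scheme \<Rightarrow> 'a set \<Rightarrow> 'a set set" where
  "associated_primes R I =
     {P. primeideal P R \<and>
         (\<exists>f \<in> carrier R. P = {r \<in> carrier R. r \<otimes>\<^bsub>R\<^esub> f \<in> I})}"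

definition ideal_height :: "('a, 'b) ring_scheme \<Rightarrow> 'a set \<Rightarrow> enat" where
  "ideal_height R P =
     Sup {enat k | k. \<exists>Q :: nat \<Rightarrow> 'a set.
            (\<forall>i\<le>k. primeideal (Q i) R) \<and> (\<forall>i<k. Q i \<subset> Q (Suc i)) \<and> Q k = P}"

definition unmixed :: "('a, 'b) ring_scheme \<Rightarrow> 'a set \<Rightarrow> bool" where
  "unmixed R I \<longleftrightarrow>
     associated_primes R I \<subseteq> minimal_primes R I \<and>
     (\<forall>P \<in> associated_primes R I. \<forall>Q \<in> associated_primes R I.
        ideal_height R P = ideal_height R Q)"

section \<open>Polynomials and edge ideals\<close>

text \<open>Monomials are finitely supported exponent vectors, and polynomials are finitely supported
  coefficient functions on monomials; multiplication is convolution. The ring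
  \<open>K[x\<^sub>1, \<dots>, x\<^sub>n]\<close> is the subring of those polynomials in which only variables with index
  in \<open>{1..n}\<close> occur.\<close>

type_synonym 'k mpoly = "(nat \<Rightarrow>\<^sub>0 nat) \<Rightarrow>\<^sub>0 'k"

definition mpoly_ring :: "nat \<Rightarrow> 'k::field mpoly ring" where
  "mpoly_ring n =
     \<lparr>carrier = {f. \<forall>m \<in> Poly_Mapping.keys f. Poly_Mapping.keys m \<subseteq> {1..n}},
      mult = (*), one = 1, zero = 0, add = (+)\<rparr>"

definition mpoly_var :: "nat \<Rightarrow> 'k::field mpoly" where
  "mpoly_var i = Poly_Mapping.single (Poly_Mapping.single i 1) 1"

lemma cring_mpoly_ring: "cring (mpoly_ring n :: 'k::field mpoly ring)"
proof (rule cringI)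
  let ?R = "mpoly_ring n :: 'k mpoly ring"
  have carrier: "f \<in> carrier ?R \<longleftrightarrow> (\<forall>m \<in> Poly_Mapping.keys f. Poly_Mapping.keys m \<subseteq> {1..n})" for f
    by (simp add: mpoly_ring_def)
  have minus: "- f \<in> carrier ?R" if "f \<in> carrier ?R" for f
    using that by (simp add: carrier)
  have add: "f + g \<in> carrier ?R" if "f \<in> carrier ?R" "g \<in> carrier ?R" for f g
    using that Poly_Mapping.keys_add[of f g] unfolding carrier by blast
  have mult: "f * g \<in> carrier ?R" if f: "f \<in> carrier ?R" and g: "g \<in> carrier ?R" for f g
    unfolding carrier
  proof
    fix m assume "m \<in> Poly_Mapping.keys (f * g)"
    then obtain a b where "m = a + b" "a \<in> Poly_Mapping.keys f" "b \<in> Poly_Mapping.keys g"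
      using Poly_Mapping.keys_mult[of f g] by blast
    then show "Poly_Mapping.keys m \<subseteq> {1..n}"
      using f g Poly_Mapping.keys_add[of a b] unfolding carrier by blast
  qed
  have zero: "0 \<in> carrier ?R" and one: "1 \<in> carrier ?R"
    by (simp_all add: carrier)
  have ops [simp]: "mult ?R = (*)" "one ?R = 1" "zero ?R = 0" "add ?R = (+)"
    by (simp_all add: mpoly_ring_def)
  show "abelian_group ?R"
  proof (rule abelian_groupI)
    show "\<exists>g \<in> carrier ?R. g \<oplus>\<^bsub>?R\<^esub> f = \<zero>\<^bsub>?R\<^esub>" if "f \<in> carrier ?R" for f
      by (rule bexI[OF _ minus[OF that]]) simp
  qed (simp_all add: add zero add_ac)
  show "Group.comm_monoid ?R"
    by (rule comm_monoidI) (simp_all add: mult one mult_ac)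
qed (simp add: mpoly_ring_def distrib_right)

lemma mpoly_var_carrier: "i \<in> {1..n} \<Longrightarrow> mpoly_var i \<in> carrier (mpoly_ring n)"
  by (simp add: mpoly_ring_def mpoly_var_def)

text \<open>A graph on the vertex set \<open>{1..n}\<close> is given by its set \<open>E\<close> of edges, which are
  two-element subsets of \<open>{1..n}\<close>.\<close>

definition edge_ideal :: "nat \<Rightarrow> nat set set \<Rightarrow> 'k::field mpoly set" where
  "edge_ideal n E =
     Idl\<^bsub>mpoly_ring n\<^esub> {mpoly_var i \<otimes>\<^bsub>mpoly_ring n\<^esub> mpoly_var j | i j. {i, j} \<in> E}"

section \<open>Erdos--Renyi random graphs\<close>

definition vertex_pairs :: "nat \<Rightarrow> nat set set" where
  "vertex_pairs n = {e. e \<subseteq> {1..n} \<and> card e = 2}"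

text \<open>The edge indicators are independent Bernoulli variables with parameter \<open>p\<close>. Note that
  \<^const>\<open>bernoulli_pmf\<close> truncates its parameter to the unit interval, so only
  \<open>0 \<le> p \<le> 1\<close> is meaningful.\<close>

definition gnp :: "nat \<Rightarrow> real \<Rightarrow> nat set set pmf" where
  "gnp n p =
     map_pmf (\<lambda>X. {e \<in> vertex_pairs n. X e})
       (Pi_pmf (vertex_pairs n) False (\<lambda>_. bernoulli_pmf p))"

definition gnp_whp :: "(nat \<Rightarrow> real) \<Rightarrow> (nat \<Rightarrow> nat set set \<Rightarrow> bool) \<Rightarrow> bool" where
  "gnp_whp p A \<longleftrightarrow>
     (\<lambda>n. measure_pmf.prob (gnp n (p n)) {E. A n E}) \<longlonglongrightarrow> 1"

end

theory Submission
  imports Defs "HOL-Real_Asymp.Real_Asymp"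
begin

text \<open>The associated primes of an edge ideal are the ideals generated by the variables outside a
  maximal independent set \<open>S\<close>; their height is \<open>n - |S|\<close>, because the length of a chain of primes in
  the polynomial ring is at most \<open>n\<close>. So the ideal is unmixed iff all maximal independent sets have the
  same size. This holds if the graph is a matching or complete. For \<open>1 \<le> \<alpha> < 3/2\<close> it fails since
  by the second moment method some component is a path on three vertices. In the dense cases put
  \<open>q = 1 - p\<close> and choose \<open>k\<close> such that \<open>n q\<^sup>k\<close> and \<open>(k + 1)\<^sup>2 q\<^bsup>-k/2\<^esup> / n\<close> tend to zero.
  By the second moment method the numbers of independent sets of size \<open>k\<close> and \<open>k + 1\<close> are concentrated,
  and by Markov's inequality most independent sets of size \<open>k\<close> are maximal.\<close>

section \<open>Edge ideals and independent sets\<close>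

\<comment> \<open>Heights come from the bound \<open>n\<close> on chains: a chain below a prime
  generated by variables can be prolonged by adjoining the remaining variables one at a time, so it
  cannot be longer than expected. The bound itself is a count: the power products of n + 1 elements
  with exponents up to N outnumber the monomials they involve, so they satisfy a linear relation,
  which elements picked from the steps of a chain cannot do. In the sparse range 3/2 is the exponent
  at which n^3 p^2, the order of the number of pairs of adjacent edges, changes from large to small;
  \<alpha> \<ge> 1 keeps p \<le> 1/n, so that isolating a path costs only a constant factor. In the
  dense range n q^k bounds the expected number of vertices that extend a given independent k-set,
  while the other quantity bounds what each common vertex of two k-sets adds to the second moment.
  Up to lower-order terms both vanish when k lies strictly between log n and 2 log n, logarithms to
  base 1/q. Constant q leaves ample room. For q = n^(-\<alpha>) the window runs from 1/\<alpha> to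
  2/\<alpha> and must contain an integer, which fails for \<alpha> = 1.\<close>
alias lookup = Poly_Mapping.lookup
alias keys = Poly_Mapping.keys
alias single = Poly_Mapping.single

text \<open>If \<open>J\<close> is not inside the prime, some a in \<open>J\<close> avoids it.
  Multiplying an element of the remaining intersection by a lands in the whole intersection, and
  primality cancels a. The factor \<open>carrier R\<close> makes the empty intersection
  meaningful.\<close>

lemma (in primeideal) finite_Inter_subset_imp:
  assumes "finite F" "\<And>J. J \<in> F \<Longrightarrow> ideal J R" "carrier R \<inter> \<Inter>F \<subseteq> I"
  shows "\<exists>J\<in>F. J \<subseteq> I"
  using assms
proof (induction F rule: finite_induct)
  case empty
  then show ?case using I_notcarr a_subset by auto
next
  case (insert J F)
  show ?case
  proof (cases "J \<subseteq> I")
    case False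
    then obtain a where a: "a \<in> J" "a \<notin> I" by blast
    have J: "ideal J R" using insert.prems(1) by simp
    have "x \<in> I" if x: "x \<in> carrier R" "x \<in> \<Inter>F" for x
    proof -
      have "x \<otimes> a \<in> K" if K: "K \<in> insert J F" for K
      proof (cases "K = J")
        case True
        then show ?thesis using ideal.I_l_closed[OF J a(1) x(1)] by simp
      next
        case False
        then have "x \<in> K" using K x(2) by simp
        then show ?thesis
          using ideal.I_r_closed[OF insert.prems(1)[OF K]] ideal.Icarr[OF J a(1)] by blast
      qed
      then have "x \<otimes> a \<in> I" using insert.prems(2) x a ideal.Icarr[OF J] by auto
      then show "x \<in> I" using I_prime x a ideal.Icarr[OF J] by blast
    qed
    then show ?thesis using insert.IH insert.prems(1) by blast
  qed blast
qed

text \<open>For an intersection of primes, the colon ideal by f is the intersection of those members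
  that do not contain f. If it is prime, it contains one of these members and hence equals
  it.\<close>

lemma associated_primes_Inter_subset:
  assumes "finite F" "\<And>J. J \<in> F \<Longrightarrow> primeideal J R" "I = carrier R \<inter> \<Inter>F"
  shows "associated_primes R I \<subseteq> F"
proof
  fix P assume "P \<in> associated_primes R I"
  then obtain f where P: "primeideal P R" and f: "f \<in> carrier R"
    and P_eq: "P = {r \<in> carrier R. r \<otimes>\<^bsub>R\<^esub> f \<in> I}"
    by (auto simp: associated_primes_def)
  interpret P: primeideal P R by fact
  let ?F = "{J \<in> F. f \<notin> J}"
  have id: "ideal J R" if "J \<in> F" for J
    using assms(2)[OF that] primeideal.axioms(1) by blast
  have "r \<otimes>\<^bsub>R\<^esub> f \<in> J \<longleftrightarrow> r \<in> J \<or> f \<in> J" if "J \<in> F" "r \<in> carrier R" for J r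
    using primeideal.I_prime[OF assms(2)[OF that(1)] that(2) f]
      ideal.I_l_closed[OF id[OF that(1)] _ that(2)] ideal.I_r_closed[OF id[OF that(1)] _ f] by blast
  then have "r \<otimes>\<^bsub>R\<^esub> f \<in> I \<longleftrightarrow> (\<forall>J\<in>?F. r \<in> J)" if "r \<in> carrier R" for r
    using P.m_closed[OF that f] that unfolding assms(3) by blast
  then have eq: "P = carrier R \<inter> \<Inter>?F"
    unfolding P_eq by blast
  with P.finite_Inter_subset_imp[of ?F] id assms(1) obtain J where "J \<in> ?F" "J \<subseteq> P"
    by auto
  moreover have "P \<subseteq> J" using eq \<open>J \<in> ?F\<close> by blast
  ultimately show "P \<in> F" by auto
qed

section \<open>Monomial ideals and ideals generated by variables\<close>

lemma mpoly_ring_simps [simp]: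
  "mult (mpoly_ring n) = (*)" "one (mpoly_ring n) = 1" "zero (mpoly_ring n) = 0"
  "add (mpoly_ring n) = (+)"
  by (simp_all add: mpoly_ring_def)

lemma mem_carrier_mpoly_ring:
  "f \<in> carrier (mpoly_ring n) \<longleftrightarrow> (\<forall>m\<in>keys f. keys m \<subseteq> {1..n})"
  by (simp add: mpoly_ring_def)

lemma keys_plus_nat: "keys (a + b) = keys a \<union> keys (b :: 'a \<Rightarrow>\<^sub>0 nat)"
  by (auto simp: in_keys_iff lookup_add)

lemma lookup_sum_single:
  "finite A \<Longrightarrow> lookup (\<Sum>m\<in>A. single m (c m)) k = (if k \<in> A then c k else 0)"
  by (simp add: lookup_sum lookup_single when_def)

lemma sum_single_keys: "(\<Sum>m\<in>keys f. single m (lookup f m)) = f"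
  by (rule poly_mapping_eqI) (simp add: lookup_sum_single in_keys_iff)

lemma a_inv_mpoly_ring:
  fixes f :: "'k::field mpoly"
  assumes "f \<in> carrier (mpoly_ring n)"
  shows "\<ominus>\<^bsub>mpoly_ring n\<^esub> f = - f"
proof -
  interpret cring "mpoly_ring n :: 'k mpoly ring" by (rule cring_mpoly_ring)
  show ?thesis
    by (rule minus_equality) (use assms in \<open>auto simp: mem_carrier_mpoly_ring\<close>)
qed

text \<open>Membership is tested on each monomial through its set of variables alone, which suits
  squarefree monomial ideals. Edge ideals and ideals generated by variables both have this form,
  with an upward closed \<open>Q\<close>.\<close>

definition monomial_ideal :: "nat \<Rightarrow> (nat set \<Rightarrow> bool) \<Rightarrow> 'k::field mpoly set" where
  "monomial_ideal n Q = {f \<in> carrier (mpoly_ring n). \<forall>m\<in>keys f. Q (keys m)}"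

lemma ideal_monomial_ideal:
  assumes "\<And>A B. Q A \<Longrightarrow> A \<subseteq> B \<Longrightarrow> Q B"
  shows "ideal (monomial_ideal n Q :: 'k::field mpoly set) (mpoly_ring n)"
proof -
  let ?R = "mpoly_ring n :: 'k mpoly ring"
  interpret cring ?R by (rule cring_mpoly_ring)
  have mult: "f * g \<in> monomial_ideal n Q"
    if f: "f \<in> monomial_ideal n Q" and g: "g \<in> carrier ?R" for f g :: "'k mpoly"
  proof -
    have "Q (keys m)" if m: "m \<in> keys (f * g)" for m
    proof -
      obtain a b where "m = a + b" "a \<in> keys f"
        using keys_mult[of f g] m by blast
      then show ?thesis using f assms[of "keys a" "keys m"]
        by (auto simp: monomial_ideal_def keys_plus_nat)
    qed
    moreover have "f * g \<in> carrier ?R"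
      using f g m_closed[of f g] by (simp add: monomial_ideal_def)
    ultimately show ?thesis by (simp add: monomial_ideal_def)
  qed
  show ?thesis
  proof (rule idealI)
    show "subgroup (monomial_ideal n Q) (add_monoid ?R)"
    proof
      fix f g :: "'k mpoly" assume fg: "f \<in> monomial_ideal n Q" "g \<in> monomial_ideal n Q"
      then have "f + g \<in> carrier ?R"
        using a_closed[of f g] by (simp add: monomial_ideal_def)
      then show "f \<otimes>\<^bsub>add_monoid ?R\<^esub> g \<in> monomial_ideal n Q"
        using fg keys_add[of f g] by (auto simp: monomial_ideal_def)
    next
      fix f :: "'k mpoly" assume "f \<in> monomial_ideal n Q"
      then show "inv\<^bsub>add_monoid ?R\<^esub> f \<in> monomial_ideal n Q"
        using a_inv_mpoly_ring[of f n] by (auto simp: monomial_ideal_def a_inv_def mem_carrier_mpoly_ring)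
    qed (auto simp: monomial_ideal_def mem_carrier_mpoly_ring)
    show "x \<otimes>\<^bsub>?R\<^esub> a \<in> monomial_ideal n Q" "a \<otimes>\<^bsub>?R\<^esub> x \<in> monomial_ideal n Q"
      if "a \<in> monomial_ideal n Q" "x \<in> carrier ?R" for a x :: "'k mpoly"
      using mult[OF that] by (simp_all add: mult.commute)
  qed (rule ring_axioms)
qed

lemma mpoly_var_mult:
  "mpoly_var i * mpoly_var j = single (single i 1 + single j 1) (1 :: 'k::field)"
  by (simp add: mpoly_var_def mult_single)

text \<open>A monomial whose support contains an edge is a multiple of the corresponding generator,
  and a polynomial is the sum of its terms.\<close>

lemma edge_ideal_eq_monomial_ideal:
  assumes E: "E \<subseteq> vertex_pairs n"
  shows "edge_ideal n E = (monomial_ideal n (\<lambda>A. \<exists>e\<in>E. e \<subseteq> A) :: 'k::field mpoly set)"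
proof -
  let ?R = "mpoly_ring n :: 'k mpoly ring"
  let ?M = "monomial_ideal n (\<lambda>A. \<exists>e\<in>E. e \<subseteq> A) :: 'k mpoly set"
  let ?G = "{mpoly_var i \<otimes>\<^bsub>?R\<^esub> mpoly_var j | i j. {i, j} \<in> E}"
  interpret cring ?R by (rule cring_mpoly_ring)
  have vert: "i \<in> {1..n}" "j \<in> {1..n}" "i \<noteq> j" if "{i, j} \<in> E" for i j
    using that E by (auto simp: vertex_pairs_def card_insert_if split: if_splits)
  have GM: "?G \<subseteq> ?M"
  proof
    fix f assume "f \<in> ?G"
    then obtain i j where f: "f = mpoly_var i * mpoly_var j" and ij: "{i, j} \<in> E" by auto
    from ij have "\<exists>e\<in>E. e \<subseteq> {i, j}" by blast
    then show "f \<in> ?M"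
      using vert[OF ij]
      by (simp add: f monomial_ideal_def mem_carrier_mpoly_ring mpoly_var_mult keys_plus_nat
          insert_commute)
  qed
  moreover have "?M \<subseteq> carrier ?R" by (auto simp: monomial_ideal_def)
  ultimately have G: "?G \<subseteq> carrier ?R" by blast
  interpret I: ideal "Idl\<^bsub>?R\<^esub> ?G" ?R by (rule genideal_ideal[OF G])
  have "?M \<subseteq> Idl\<^bsub>?R\<^esub> ?G"
  proof
    fix f :: "'k mpoly" assume f: "f \<in> ?M"
    have single: "single m c \<in> Idl\<^bsub>?R\<^esub> ?G" if m: "m \<in> keys f" for m c
    proof -
      obtain e where e: "e \<in> E" "e \<subseteq> keys m" using f m by (auto simp: monomial_ideal_def)
      then obtain i j where ij: "e = {i, j}" "i \<noteq> j"
        using E by (auto simp: vertex_pairs_def card_2_iff)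
      \<comment> \<open>The exponent vector of the quotient. The truncated subtraction is exact,
        because i and j are distinct and both occur in \<open>m\<close>.\<close>
      define m' where "m' = m - (single i 1 + single j 1)"
      have "m = m' + (single i 1 + single j 1)"
      proof (rule poly_mapping_eqI)
        fix k
        have "lookup (single i 1 + single j 1) k \<le> lookup m k"
          using e ij by (auto simp: lookup_add lookup_single when_def in_keys_iff)
        then show "lookup m k = lookup (m' + (single i 1 + single j 1)) k"
          by (simp add: m'_def lookup_add lookup_minus)
      qed
      then have eq: "single m c = single m' c * (mpoly_var i * mpoly_var j)"
        by (simp add: mpoly_var_mult mult_single)
      have "keys m' \<subseteq> keys m" by (auto simp: m'_def in_keys_iff lookup_minus)
      then have "single m' c \<in> carrier ?R"
        using f m by (auto simp: monomial_ideal_def mem_carrier_mpoly_ring)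
      moreover have "mpoly_var i * mpoly_var j \<in> Idl\<^bsub>?R\<^esub> ?G"
        using genideal_self[OF G] e ij by force
      ultimately show ?thesis using I.I_l_closed unfolding eq by fastforce
    qed
    have "(\<Sum>m\<in>A. single m (lookup f m)) \<in> Idl\<^bsub>?R\<^esub> ?G" if "A \<subseteq> keys f" "finite A" for A
      using that(2,1)
    proof (induction A rule: finite_induct)
      case empty
      then show ?case using I.zero_closed by simp
    next
      case (insert m A)
      then show ?case using I.a_closed[OF single[of m "lookup f m"]] by simp
    qed
    from this[of "keys f"] show "f \<in> Idl\<^bsub>?R\<^esub> ?G" by (simp add: sum_single_keys)
  qed
  moreover have "Idl\<^bsub>?R\<^esub> ?G \<subseteq> ?M"
    by (rule genideal_minimal[OF ideal_monomial_ideal GM]) blast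
  ultimately show ?thesis unfolding edge_ideal_def by blast
qed

definition var_ideal :: "nat \<Rightarrow> nat set \<Rightarrow> 'k::field mpoly set" where
  "var_ideal n C = monomial_ideal n (\<lambda>A. A \<inter> C \<noteq> {})"

text \<open>Modulo the ideal a polynomial may be replaced by its part free of the variables in
  \<open>C\<close>. A product of two such parts is again free of them, so it lies in the ideal only
  if it is 0, and then one factor is 0.\<close>

lemma primeideal_var_ideal:
  "primeideal (var_ideal n C :: 'k::field mpoly set) (mpoly_ring n)"
proof (rule primeidealI)
  let ?R = "mpoly_ring n :: 'k mpoly ring"
  interpret cring ?R by (rule cring_mpoly_ring)
  show "ideal (var_ideal n C :: 'k mpoly set) ?R"
    unfolding var_ideal_def by (rule ideal_monomial_ideal) blast
  then interpret ideal "var_ideal n C :: 'k mpoly set" ?R .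
  show "cring ?R" ..
  have "\<not> (\<forall>m\<in>keys (1 :: 'k mpoly). keys m \<inter> C \<noteq> {})"
    unfolding keys_one by simp
  then have "1 \<notin> (var_ideal n C :: 'k mpoly set)"
    unfolding var_ideal_def monomial_ideal_def by blast
  then show "carrier ?R \<noteq> var_ideal n C"
    using one_closed by auto
  fix f g :: "'k mpoly"
  assume f: "f \<in> carrier ?R" and g: "g \<in> carrier ?R" and fg: "f \<otimes>\<^bsub>?R\<^esub> g \<in> var_ideal n C"
  \<comment> \<open>The effect of setting all variables of \<open>C\<close> to 0.\<close>
  define r where "r = (\<lambda>f :: 'k mpoly. \<Sum>m\<in>{m\<in>keys f. keys m \<inter> C = {}}. single m (lookup f m))"
  have lookup_r: "lookup (r h) m = (if keys m \<inter> C = {} then lookup h m else 0)" for h m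
    by (simp add: r_def lookup_sum_single in_keys_iff)
  have keys_r: "keys (r h) = {m \<in> keys h. keys m \<inter> C = {}}" for h
    unfolding in_keys_iff lookup_r set_eq_iff mem_Collect_eq by presburger
  have split: "h - r h \<in> var_ideal n C" "r h \<in> carrier ?R" if "h \<in> carrier ?R" for h
  proof -
    have "keys (h - r h) = {m \<in> keys h. keys m \<inter> C \<noteq> {}}"
      unfolding in_keys_iff lookup_r lookup_minus set_eq_iff mem_Collect_eq by simp
    then show "h - r h \<in> var_ideal n C"
      using that by (auto simp: var_ideal_def monomial_ideal_def mem_carrier_mpoly_ring)
    show "r h \<in> carrier ?R" using that by (auto simp: keys_r mem_carrier_mpoly_ring)
  qed
  have "f * g = (r f * r g + r f * (g - r g)) + (f - r f) * g"
    by (simp add: algebra_simps)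
  moreover have c: "r f * (g - r g) \<in> var_ideal n C" "(f - r f) * g \<in> var_ideal n C"
    using I_l_closed[OF split(1)[OF g] split(2)[OF f]] I_r_closed[OF split(1)[OF f] g] by simp_all
  ultimately have "r f * r g = f * g \<ominus>\<^bsub>?R\<^esub> (r f * (g - r g) + (f - r f) * g)"
    using a_inv_mpoly_ring[OF Icarr[OF a_closed[OF c]]] by (simp add: a_minus_def)
  then have "r f * r g \<in> var_ideal n C"
    using fg c a_closed by (simp add: a_minus_def)
  moreover have "keys m \<inter> C = {}" if m: "m \<in> keys (r f * r g)" for m
  proof -
    obtain a b where "m = a + b" "a \<in> keys (r f)" "b \<in> keys (r g)"
      using keys_mult[of "r f" "r g"] m by blast
    then show ?thesis by (auto simp: keys_r keys_plus_nat)
  qed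
  ultimately have "keys (r f * r g) = {}"
    unfolding var_ideal_def monomial_ideal_def by blast
  then have "r f = 0 \<or> r g = 0" unfolding keys_eq_empty mult_eq_0_iff .
  then show "f \<in> var_ideal n C \<or> g \<in> var_ideal n C"
    using split(1)[OF f] split(1)[OF g] by (metis diff_zero)
qed

section \<open>Maximal independent sets and the primes of the edge ideal\<close>

definition indep_set :: "nat \<Rightarrow> nat set set \<Rightarrow> nat set \<Rightarrow> bool" where
  "indep_set n E S \<longleftrightarrow> S \<subseteq> {1..n} \<and> (\<forall>e\<in>E. \<not> e \<subseteq> S)"

definition max_indep_set :: "nat \<Rightarrow> nat set set \<Rightarrow> nat set \<Rightarrow> bool" where
  "max_indep_set n E S \<longleftrightarrow> indep_set n E S \<and> (\<forall>T. indep_set n E T \<and> S \<subseteq> T \<longrightarrow> T = S)"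

lemma max_indep_set_subset: "max_indep_set n E S \<Longrightarrow> S \<subseteq> {1..n}"
  by (simp add: max_indep_set_def indep_set_def)

lemma finite_indep_sets: "finite {S. indep_set n E S}"
  by (rule finite_subset[of _ "Pow {1..n}"]) (auto simp: indep_set_def)

lemma indep_set_extends:
  assumes "indep_set n E A"
  obtains S where "max_indep_set n E S" "A \<subseteq> S"
proof -
  obtain S where "S \<in> {S. indep_set n E S}" "A \<subseteq> S" "\<forall>T\<in>{S. indep_set n E S}. S \<subseteq> T \<longrightarrow> T = S"
    using finite_has_maximal2[OF finite_indep_sets, of A n E] assms by auto
  then show ?thesis using that[of S] by (auto simp: max_indep_set_def)
qed

lemma mpoly_carrier_plus:
  "f \<in> carrier (mpoly_ring n) \<Longrightarrow> g \<in> carrier (mpoly_ring n) \<Longrightarrow> f + g \<in> carrier (mpoly_ring n)"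
  using keys_add[of f g] by (auto simp: mem_carrier_mpoly_ring)

lemma mpoly_carrier_mult:
  assumes "f \<in> carrier (mpoly_ring n)" "g \<in> carrier (mpoly_ring n)"
  shows "f * g \<in> carrier (mpoly_ring n :: 'k::field mpoly ring)"
proof -
  interpret cring "mpoly_ring n :: 'k mpoly ring" by (rule cring_mpoly_ring)
  show ?thesis using m_closed[OF assms] unfolding mpoly_ring_simps .
qed

lemma mpoly_carrier_0 [simp]: "0 \<in> carrier (mpoly_ring n)"
  and mpoly_carrier_1 [simp]: "1 \<in> carrier (mpoly_ring n)"
  by (simp_all add: mem_carrier_mpoly_ring)

lemma mpoly_carrier_power:
  "f \<in> carrier (mpoly_ring n) \<Longrightarrow> f ^ k \<in> carrier (mpoly_ring n :: 'k::field mpoly ring)"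
  by (induction k) (simp_all add: mpoly_carrier_mult)

lemma mpoly_carrier_const [simp]: "single 0 c \<in> carrier (mpoly_ring n)"
  by (simp add: mem_carrier_mpoly_ring)

lemma mpoly_ideal_mult:
  fixes I :: "'k::field mpoly set"
  assumes "ideal I (mpoly_ring n)" "f \<in> I" "g \<in> carrier (mpoly_ring n)"
  shows "g * f \<in> I" "f * g \<in> I"
proof -
  have "g \<otimes>\<^bsub>mpoly_ring n\<^esub> f \<in> I" by (rule ideal.I_l_closed[OF assms])
  then show "g * f \<in> I" unfolding mpoly_ring_simps .
  then show "f * g \<in> I" by (subst mult.commute)
qed

lemma mpoly_ideal_diff:
  fixes I :: "'k::field mpoly set"
  assumes I: "ideal I (mpoly_ring n)" and fg: "f \<in> I" "g \<in> I"
  shows "f - g \<in> I"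
proof -
  have "- g = single 0 (- 1) * g"
    by (simp add: single_uminus)
  then have "- g \<in> I" using mpoly_ideal_mult(1)[OF I fg(2), of "single 0 (- 1)"] by simp
  then show ?thesis
    using additive_subgroup.a_closed[OF ideal.axioms(1)[OF I] fg(1), of "- g"] by simp
qed

lemma mpoly_ideal_sum:
  fixes I :: "'k::field mpoly set"
  assumes I: "ideal I (mpoly_ring n)" and "\<And>a. a \<in> A \<Longrightarrow> f a \<in> I"
  shows "(\<Sum>a\<in>A. f a) \<in> I"
  using assms(2)
proof (induction A rule: infinite_finite_induct)
  case (insert a A)
  then show ?case
    using additive_subgroup.a_closed[OF ideal.axioms(1)[OF I], of "f a" "sum f A"] by simp
qed (use additive_subgroup.zero_closed[OF ideal.axioms(1)[OF I]] in simp_all)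

lemma mem_var_ideal:
  "f \<in> var_ideal n C \<longleftrightarrow> f \<in> carrier (mpoly_ring n) \<and> (\<forall>m\<in>keys f. keys m \<inter> C \<noteq> {})"
  by (simp add: var_ideal_def monomial_ideal_def)

lemma mpoly_var_mem_var_ideal:
  "i \<in> {1..n} \<Longrightarrow> (mpoly_var i :: 'k::field mpoly) \<in> var_ideal n C \<longleftrightarrow> i \<in> C"
  by (simp add: mem_var_ideal mem_carrier_mpoly_ring mpoly_var_def)

lemma var_ideal_mono: "C \<subseteq> D \<Longrightarrow> var_ideal n C \<subseteq> var_ideal n D"
  by (auto simp only: mem_var_ideal subset_iff)

lemma var_ideal_subset_imp:
  assumes "C \<subseteq> {1..n}" "var_ideal n C \<subseteq> (var_ideal n D :: 'k::field mpoly set)"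
  shows "C \<subseteq> D"
proof
  fix i assume "i \<in> C"
  then have "i \<in> {1..n}" using assms(1) by blast
  then show "i \<in> D"
    using mpoly_var_mem_var_ideal[of i n C, where 'k = 'k]
      mpoly_var_mem_var_ideal[of i n D, where 'k = 'k] \<open>i \<in> C\<close> assms(2) by blast
qed

text \<open>The complements \<open>{1..n} - S\<close> are exactly the minimal vertex covers of the
  graph.\<close>

definition indep_primes :: "nat \<Rightarrow> nat set set \<Rightarrow> 'k::field mpoly set set" where
  "indep_primes n E = {var_ideal n ({1..n} - S) | S. max_indep_set n E S}"

lemma finite_indep_primes: "finite (indep_primes n E)"
proof -
  have "finite {S. max_indep_set n E S}"
    by (rule finite_subset[OF _ finite_indep_sets[of n E]]) (auto simp: max_indep_set_def)
  then show ?thesis by (simp add: indep_primes_def)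
qed

text \<open>A set of variables contains no edge iff it fits into some maximal independent set. So a
  support contains an edge iff it meets the complement of each of them.\<close>

lemma edge_ideal_eq_Inter:
  assumes E: "E \<subseteq> vertex_pairs n"
  shows "edge_ideal n E = carrier (mpoly_ring n) \<inter> \<Inter>(indep_primes n E :: 'k::field mpoly set set)"
proof -
  have "(\<exists>e\<in>E. e \<subseteq> A) \<longleftrightarrow> (\<forall>S. max_indep_set n E S \<longrightarrow> A \<inter> ({1..n} - S) \<noteq> {})"
    if "A \<subseteq> {1..n}" for A
  proof
    assume "\<exists>e\<in>E. e \<subseteq> A"
    then obtain e where e: "e \<in> E" "e \<subseteq> A" by blast
    have "\<not> e \<subseteq> S" if "max_indep_set n E S" for S
      using that e(1) by (simp add: max_indep_set_def indep_set_def)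
    then show "\<forall>S. max_indep_set n E S \<longrightarrow> A \<inter> ({1..n} - S) \<noteq> {}"
      using e(2) that by blast
  next
    assume *: "\<forall>S. max_indep_set n E S \<longrightarrow> A \<inter> ({1..n} - S) \<noteq> {}"
    have "\<not> indep_set n E A"
    proof
      assume "indep_set n E A"
      then obtain S where "max_indep_set n E S" "A \<subseteq> S" by (rule indep_set_extends)
      then show False using * by blast
    qed
    then show "\<exists>e\<in>E. e \<subseteq> A" using that by (simp add: indep_set_def)
  qed
  then have "(edge_ideal n E :: 'k mpoly set) = {f \<in> carrier (mpoly_ring n). \<forall>m\<in>keys f.
      \<forall>S. max_indep_set n E S \<longrightarrow> keys m \<inter> ({1..n} - S) \<noteq> {}}"
    unfolding edge_ideal_eq_monomial_ideal[OF E] monomial_ideal_def mem_carrier_mpoly_ring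
    by (intro Collect_cong conj_cong ball_cong refl) simp
  also have "\<dots> = carrier (mpoly_ring n) \<inter> \<Inter>(indep_primes n E)"
  proof (rule Set.set_eqI)
    fix f :: "'k mpoly"
    have "f \<in> \<Inter>(indep_primes n E) \<longleftrightarrow>
        (\<forall>S. max_indep_set n E S \<longrightarrow> f \<in> var_ideal n ({1..n} - S))"
      by (auto simp only: indep_primes_def)
    then show "f \<in> {f \<in> carrier (mpoly_ring n). \<forall>m\<in>keys f.
        \<forall>S. max_indep_set n E S \<longrightarrow> keys m \<inter> ({1..n} - S) \<noteq> {}} \<longleftrightarrow>
        f \<in> carrier (mpoly_ring n) \<inter> \<Inter>(indep_primes n E)"
      unfolding Int_iff mem_Collect_eq mem_var_ideal by metis
  qed
  finally show ?thesis .
qed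

lemma lookup_mult_single_1:
  "lookup (f * single a (1 :: 'k::field)) (m + a) = lookup f (m :: nat \<Rightarrow>\<^sub>0 nat)"
proof -
  have "f * single a 1 = (\<Sum>m\<in>keys f. single m (lookup f m)) * single a 1"
    by (simp add: sum_single_keys)
  also have "\<dots> = (\<Sum>m\<in>keys f. single (m + a) (lookup f m))"
    by (simp add: sum_distrib_right mult_single)
  finally show ?thesis
    by (simp add: lookup_sum lookup_single when_def in_keys_iff)
qed

lemma keys_mult_single_1:
  "keys (f * single a (1 :: 'k::field)) = (\<lambda>m. m + a) ` keys (f :: 'k mpoly)"
proof
  show "keys (f * single a 1) \<subseteq> (\<lambda>m. m + a) ` keys f"
    using keys_mult[of f "single a (1 :: 'k)"] by auto
  show "(\<lambda>m. m + a) ` keys f \<subseteq> keys (f * single a 1)"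
    unfolding image_subset_iff in_keys_iff[of "_ + a"] lookup_mult_single_1
    by (simp add: in_keys_iff)
qed

text \<open>For a maximal independent set \<open>S\<close>, the prime of the complement is the colon ideal
  of the edge ideal by the product of the variables in \<open>S\<close>.\<close>

lemma associated_primes_edge_ideal:
  assumes E: "E \<subseteq> vertex_pairs n"
  shows "associated_primes (mpoly_ring n) (edge_ideal n E :: 'k::field mpoly set) = indep_primes n E"
proof
  show "associated_primes (mpoly_ring n) (edge_ideal n E :: 'k mpoly set) \<subseteq> indep_primes n E"
    by (rule associated_primes_Inter_subset[OF finite_indep_primes _ edge_ideal_eq_Inter[OF E]])
      (auto simp: indep_primes_def primeideal_var_ideal)
next
  let ?R = "mpoly_ring n :: 'k mpoly ring"
  show "indep_primes n E \<subseteq> associated_primes ?R (edge_ideal n E)"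
  proof
    fix P :: "'k mpoly set" assume "P \<in> indep_primes n E"
    then obtain S where S: "max_indep_set n E S" and P: "P = var_ideal n ({1..n} - S)"
      by (auto simp: indep_primes_def)
    have Sn: "S \<subseteq> {1..n}" and "finite S"
      using max_indep_set_subset[OF S] finite_subset by blast+
    define a :: "nat \<Rightarrow>\<^sub>0 nat" where "a = (\<Sum>i\<in>S. single i 1)"
    have keys_a: "keys a = S"
      unfolding set_eq_iff in_keys_iff a_def lookup_sum_single[OF \<open>finite S\<close>] by simp
    have a_carr: "single a 1 \<in> carrier ?R"
      using Sn by (simp add: mem_carrier_mpoly_ring keys_a)
    \<comment> \<open>Independence of \<open>S\<close> gives one direction; maximality gives the
      other, since any vertex added to \<open>S\<close> creates an edge.\<close>
    have *: "(\<exists>e\<in>E. e \<subseteq> A \<union> S) \<longleftrightarrow> A \<inter> ({1..n} - S) \<noteq> {}" if "A \<subseteq> {1..n}" for A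
    proof
      assume "\<exists>e\<in>E. e \<subseteq> A \<union> S"
      moreover have "\<forall>e\<in>E. \<not> e \<subseteq> S"
        using S by (simp add: max_indep_set_def indep_set_def)
      ultimately show "A \<inter> ({1..n} - S) \<noteq> {}"
        using that by blast
    next
      assume "A \<inter> ({1..n} - S) \<noteq> {}"
      then have "A \<union> S \<noteq> S" by blast
      then have "\<not> indep_set n E (A \<union> S)"
        using S unfolding max_indep_set_def by blast
      then show "\<exists>e\<in>E. e \<subseteq> A \<union> S" using that Sn by (simp add: indep_set_def)
    qed
    have "r * single a 1 \<in> edge_ideal n E \<longleftrightarrow> r \<in> P" if r: "r \<in> carrier ?R" for r :: "'k mpoly"
    proof -
      have "r * single a 1 \<in> edge_ideal n E \<longleftrightarrow> (\<forall>m\<in>keys r. \<exists>e\<in>E. e \<subseteq> keys m \<union> S)"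
        using mpoly_carrier_mult[OF r a_carr]
        by (simp add: edge_ideal_eq_monomial_ideal[OF E] monomial_ideal_def keys_mult_single_1
            keys_plus_nat keys_a)
      also have "\<dots> \<longleftrightarrow> r \<in> P"
        using r * unfolding P mem_var_ideal by (simp add: mem_carrier_mpoly_ring)
      finally show ?thesis .
    qed
    then have "P = {r \<in> carrier ?R. r \<otimes>\<^bsub>?R\<^esub> single a 1 \<in> edge_ideal n E}"
      unfolding P by (auto simp: mem_var_ideal)
    moreover have "primeideal P ?R" unfolding P by (rule primeideal_var_ideal)
    ultimately show "P \<in> associated_primes ?R (edge_ideal n E)"
      unfolding associated_primes_def using a_carr by blast
  qed
qed

text \<open>A prime \<open>Q\<close> between the edge ideal and the prime of \<open>S\<close>
  contains the prime of some maximal independent \<open>T\<close>. Comparing variables gives that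
  \<open>T\<close> includes \<open>S\<close>, so both are equal and \<open>Q\<close> is
  squeezed.\<close>

lemma minimal_primes_edge_ideal:
  assumes E: "E \<subseteq> vertex_pairs n"
  shows "indep_primes n E \<subseteq> minimal_primes (mpoly_ring n) (edge_ideal n E :: 'k::field mpoly set)"
proof
  let ?R = "mpoly_ring n :: 'k mpoly ring"
  fix P :: "'k mpoly set" assume P_mem: "P \<in> indep_primes n E"
  then obtain S where S: "max_indep_set n E S" and P: "P = var_ideal n ({1..n} - S)"
    by (auto simp: indep_primes_def)
  have "Q = P" if Q: "primeideal Q ?R" "edge_ideal n E \<subseteq> Q" "Q \<subseteq> P" for Q
  proof -
    have "\<exists>J\<in>indep_primes n E. J \<subseteq> Q"
    proof (rule primeideal.finite_Inter_subset_imp[OF Q(1) finite_indep_primes])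
      show "ideal J ?R" if "J \<in> indep_primes n E" for J
        using that primeideal_var_ideal primeideal.axioms(1) by (auto simp: indep_primes_def)
    qed (use Q(2) edge_ideal_eq_Inter[OF E] in auto)
    then obtain T where T: "max_indep_set n E T" "var_ideal n ({1..n} - T) \<subseteq> Q"
      by (auto simp: indep_primes_def)
    have "var_ideal n ({1..n} - T) \<subseteq> P"
      by (rule subset_trans[OF T(2) Q(3)])
    then have "{1..n} - T \<subseteq> {1..n} - S"
      unfolding P by (rule var_ideal_subset_imp[OF Diff_subset])
    then have "S \<subseteq> T"
      using max_indep_set_subset[OF S] by blast
    then have "S = T"
      using S T(1) by (simp add: max_indep_set_def)
    then show "Q = P" using T(2) Q(3) unfolding P by (intro equalityI) simp_all
  qed
  moreover have "primeideal P ?R" unfolding P by (rule primeideal_var_ideal)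
  ultimately show "P \<in> minimal_primes ?R (edge_ideal n E)"
    using Inter_lower[OF P_mem] unfolding minimal_primes_def edge_ideal_eq_Inter[OF E] by blast
qed

section \<open>Heights\<close>

text \<open>Fewer homogeneous equations than unknowns: Gaussian elimination, one equation
  \<open>b\<close> and one pivot unknown \<open>a0\<close> at a time.\<close>

lemma homogeneous_system_solvable:
  fixes v :: "'a \<Rightarrow> 'b \<Rightarrow> 'k::field"
  assumes "finite B" "finite A" "card B < card A"
  shows "\<exists>c. (\<exists>a\<in>A. c a \<noteq> 0) \<and> (\<forall>b\<in>B. (\<Sum>a\<in>A. c a * v a b) = 0)"
  using assms
proof (induction B arbitrary: A v rule: finite_induct)
  case empty
  then have "A \<noteq> {}" by auto
  then show ?case by (intro exI[of _ "\<lambda>_. 1"]) auto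
next
  case (insert b B)
  show ?case
  proof (cases "\<forall>a\<in>A. v a b = 0")
    case True
    have "card B < card A" using insert by simp
    then obtain c where "\<exists>a\<in>A. c a \<noteq> 0" "\<forall>b\<in>B. (\<Sum>a\<in>A. c a * v a b) = 0"
      using insert.IH[of A v] insert.prems by auto
    then show ?thesis using True by (intro exI[of _ c]) auto
  next
    case False
    then obtain a0 where a0: "a0 \<in> A" "v a0 b \<noteq> 0" by auto
    define A' where "A' = A - {a0}"
    \<comment> \<open>The coefficients left in the other equations after equation \<open>b\<close>
      has been solved for the unknown \<open>a0\<close>.\<close>
    define w where "w = (\<lambda>a b'. v a b' - v a b / v a0 b * v a0 b')"
    have A: "A = insert a0 A'" "a0 \<notin> A'" "finite A'"
      using a0 insert.prems by (auto simp: A'_def)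
    then have "card B < card A'" using insert by simp
    then obtain c where c: "\<exists>a\<in>A'. c a \<noteq> 0" "\<forall>b\<in>B. (\<Sum>a\<in>A'. c a * w a b) = 0"
      using insert.IH[of A' w] A by auto
    \<comment> \<open>Back substitution: the value at \<open>a0\<close> is forced by equation
      \<open>b\<close>.\<close>
    define d where "d = c(a0 := - (\<Sum>a\<in>A'. c a * v a b) / v a0 b)"
    have d_sum: "(\<Sum>a\<in>A. d a * v a b') = (\<Sum>a\<in>A'. c a * w a b')" for b'
    proof -
      have "(\<Sum>a\<in>A'. d a * v a b') = (\<Sum>a\<in>A'. c a * v a b')"
        by (rule sum.cong) (use A in \<open>auto simp: d_def\<close>)
      then have "(\<Sum>a\<in>A. d a * v a b') =
          (\<Sum>a\<in>A'. c a * v a b') - (\<Sum>a\<in>A'. c a * v a b) / v a0 b * v a0 b'"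
        using A by (simp add: d_def)
      also have "\<dots> = (\<Sum>a\<in>A'. c a * w a b')"
        by (simp add: w_def algebra_simps sum_subtractf sum_distrib_left sum_divide_distrib)
      finally show ?thesis .
    qed
    have "w a b = 0" for a using a0 by (simp add: w_def)
    then have "\<forall>b'\<in>insert b B. (\<Sum>a\<in>A. d a * v a b') = 0"
      unfolding d_sum using c(2) by simp
    moreover have "\<exists>a\<in>A. d a \<noteq> 0"
      using c(1) A by (auto simp: d_def)
    ultimately show ?thesis by blast
  qed
qed

section \<open>Chains of primes have length at most \<open>n\<close>\<close>

fun power_product :: "'a::comm_monoid_mult list \<Rightarrow> nat list \<Rightarrow> 'a" where
  "power_product [] as = 1"
| "power_product (y # ys) as = y ^ hd as * power_product ys (tl as)"

lemma power_product_carrier: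
  assumes "set ys \<subseteq> carrier (mpoly_ring n)"
  shows "power_product ys as \<in> carrier (mpoly_ring n :: 'k::field mpoly ring)"
  using assms
  by (induction ys arbitrary: as) (simp_all add: mpoly_carrier_mult mpoly_carrier_power)

lemma const_notin_prime:
  assumes P: "primeideal P (mpoly_ring n :: 'k::field mpoly ring)" and c: "c \<noteq> 0"
  shows "single 0 c \<notin> P"
proof
  assume "single 0 c \<in> P"
  have id: "ideal P (mpoly_ring n)" using P by (rule primeideal.axioms)
  have "single 0 (inverse c) * single 0 c \<in> P"
    by (rule mpoly_ideal_mult(1)[OF id \<open>single 0 c \<in> P\<close>]) simp
  then have "one (mpoly_ring n) \<in> P"
    using c by (simp add: mult_single)
  then show False
    using ideal.one_imp_carrier[OF id] primeideal.I_notcarr[OF P] by blast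
qed

lemma power_notin_prime:
  assumes P: "primeideal P (mpoly_ring n :: 'k::field mpoly ring)"
    and y: "y \<in> carrier (mpoly_ring n)" "y \<notin> P"
  shows "y ^ k \<notin> P"
proof (induction k)
  case 0
  show ?case using const_notin_prime[OF P, of 1] by simp
next
  case (Suc k)
  then show ?case
    using primeideal.I_prime[OF P y(1) mpoly_carrier_power[OF y(1)], of k] y(2)
    by (auto simp only: mpoly_ring_simps power_Suc)
qed

text \<open>The reason is that a relation between the elements can be divided by the largest possible power
  of the first one and then reduced modulo the second prime of the chain.\<close>

lemma prime_chain_independent:
  fixes Q :: "nat \<Rightarrow> 'k::field mpoly set"
  assumes "\<And>i. i \<le> length ys \<Longrightarrow> primeideal (Q i) (mpoly_ring n)"
    and "\<And>i. i < length ys \<Longrightarrow> Q i \<subseteq> Q (Suc i)"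
    and "\<And>i. i < length ys \<Longrightarrow> ys ! i \<in> Q (Suc i) - Q i"
    and "finite A" "\<And>a. a \<in> A \<Longrightarrow> length a = length ys" "\<exists>a\<in>A. c a \<noteq> 0"
  shows "(\<Sum>a\<in>A. single 0 (c a) * power_product ys a) \<notin> Q 0"
  using assms
\<comment> \<open>Avoiding \<open>Q 0\<close>, rather than merely being nonzero, is what makes the
  induction work: the reduced relation must avoid \<open>Q 1\<close>, the start of the shifted
  chain.\<close>
proof (induction ys arbitrary: Q A c)
  case Nil
  then have "A = {[]}" by auto
  moreover from this have "c [] \<noteq> 0" using Nil.prems(6) by simp
  ultimately show ?case using const_notin_prime[OF Nil.prems(1)[of 0]] by simp
next
  case (Cons y ys)
  let ?R = "mpoly_ring n :: 'k mpoly ring"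
  have prime0: "primeideal (Q 0) ?R" and prime1: "primeideal (Q 1) ?R"
    using Cons.prems(1)[of 0] Cons.prems(1)[of 1] by simp_all
  note ideal1 = primeideal.axioms(1)[OF prime1]
  have Q01: "Q 0 \<subseteq> Q 1" and y1: "y \<in> Q 1" and y0: "y \<notin> Q 0"
    using Cons.prems(2)[of 0] Cons.prems(3)[of 0] by simp_all
  have y: "y \<in> carrier ?R" by (rule ideal.Icarr[OF ideal1 y1])
  have "ys ! i \<in> carrier ?R" if "i < length ys" for i
    using Cons.prems(3)[of "Suc i"] that
      ideal.Icarr[OF primeideal.axioms(1)[OF Cons.prems(1)[of "Suc (Suc i)"]]] by simp
  then have ys: "set ys \<subseteq> carrier ?R" by (auto simp: in_set_conv_nth)
  define B where "B = {a \<in> A. c a \<noteq> 0}"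
  \<comment> \<open>The largest power of \<open>y\<close> dividing all terms with nonzero
    coefficient. It can be cancelled, since \<open>y\<close> is outside the prime
    \<open>Q 0\<close>.\<close>
  define k where "k = Min (hd ` B)"
  have B: "finite B" "B \<noteq> {}" using Cons.prems(4,6) by (auto simp: B_def)
  have k_le: "k \<le> hd a" if "a \<in> B" for a using B that by (simp add: k_def)
  have "k \<in> hd ` B" unfolding k_def using B by (intro Min_in) auto
  have lenB: "length a = Suc (length ys)" if "a \<in> B" for a
    using Cons.prems(5)[of a] that by (simp add: B_def)
  define t where "t = (\<lambda>a. single 0 (c a) * (y ^ (hd a - k) * power_product ys (tl a)))"
  have t_carr: "t a \<in> carrier ?R" for a
    unfolding t_def
    by (intro mpoly_carrier_mult mpoly_carrier_power power_product_carrier y ys mpoly_carrier_const)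
  \<comment> \<open>After the division these terms contain no further factor \<open>y\<close>. All
    others keep one and vanish modulo \<open>Q 1\<close>.\<close>
  define B0 where "B0 = {a \<in> B. hd a = k}"
  have B0: "B0 \<noteq> {}" "finite B0" "B0 \<subseteq> B" using \<open>k \<in> hd ` B\<close> B by (auto simp: B0_def)
  have B0_Cons: "a = k # tl a" if "a \<in> B0" for a
    using lenB[of a] that by (cases a) (auto simp: B0_def)
  have "(\<Sum>a\<in>A. single 0 (c a) * power_product (y # ys) a) =
      (\<Sum>a\<in>B. single 0 (c a) * power_product (y # ys) a)"
    by (rule sum.mono_neutral_right) (use Cons.prems(4) in \<open>auto simp: B_def\<close>)
  also have "\<dots> = (\<Sum>a\<in>B. y ^ k * t a)"
  proof (rule sum.cong)
    fix a assume "a \<in> B"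
    then have "y ^ hd a = y ^ k * y ^ (hd a - k)"
      using k_le[of a] by (simp flip: power_add)
    then show "single 0 (c a) * power_product (y # ys) a = y ^ k * t a"
      by (simp add: t_def mult_ac)
  qed simp
  also have "\<dots> = y ^ k * (\<Sum>a\<in>B. t a)" by (simp add: sum_distrib_left)
  finally have eq: "(\<Sum>a\<in>A. single 0 (c a) * power_product (y # ys) a) = y ^ k * (\<Sum>a\<in>B. t a)" .
  have "(\<Sum>a\<in>B. t a) \<notin> Q 0"
  proof
    assume "(\<Sum>a\<in>B. t a) \<in> Q 0"
    then have in1: "(\<Sum>a\<in>B. t a) \<in> Q 1" using Q01 by blast
    have "t a \<in> Q 1" if "a \<in> B - B0" for a
    proof -
      have "hd a - k \<noteq> 0" using k_le[of a] that by (simp add: B0_def)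
      then obtain j where "hd a - k = Suc j" using not0_implies_Suc by blast
      then have "t a = (single 0 (c a) * (y ^ j * power_product ys (tl a))) * y"
        by (simp add: t_def mult_ac)
      then show ?thesis
        using mpoly_ideal_mult(1)[OF ideal1 y1, of "single 0 (c a) * (y ^ j * power_product ys (tl a))"]
        by (simp add: mpoly_carrier_mult mpoly_carrier_power power_product_carrier y ys)
    qed
    then have "(\<Sum>a\<in>B - B0. t a) \<in> Q 1" by (rule mpoly_ideal_sum[OF ideal1])
    then have "(\<Sum>a\<in>B. t a) - (\<Sum>a\<in>B - B0. t a) \<in> Q 1"
      by (rule mpoly_ideal_diff[OF ideal1 in1])
    also have "(\<Sum>a\<in>B. t a) - (\<Sum>a\<in>B - B0. t a) = (\<Sum>a\<in>B0. t a)"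
      using B B0 by (simp add: sum.subset_diff[of B0 B])
    also have "\<dots> = (\<Sum>a\<in>tl ` B0. single 0 (c (k # a)) * power_product ys a)"
    proof (rule sum.reindex_cong[symmetric])
      \<comment> \<open>All lists in \<open>B0\<close> have the same head \<open>k\<close>, so
        dropping it merges no terms.\<close>
      show "inj_on tl B0" by (rule inj_onI) (metis B0_Cons)
      show "single 0 (c (k # tl a)) * power_product ys (tl a) = t a" if "a \<in> B0" for a
        using B0_Cons[OF that] that by (simp add: t_def B0_def)
    qed simp
    finally have "(\<Sum>a\<in>tl ` B0. single 0 (c (k # a)) * power_product ys a) \<in> (Q \<circ> Suc) 0"
      by simp
    moreover have "(\<Sum>a\<in>tl ` B0. single 0 (c (k # a)) * power_product ys a) \<notin> (Q \<circ> Suc) 0"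
    proof (rule Cons.IH)
      show "primeideal ((Q \<circ> Suc) i) ?R" if "i \<le> length ys" for i
        using Cons.prems(1)[of "Suc i"] that by simp
      show "(Q \<circ> Suc) i \<subseteq> (Q \<circ> Suc) (Suc i)" if "i < length ys" for i
        using Cons.prems(2)[of "Suc i"] that by simp
      show "ys ! i \<in> (Q \<circ> Suc) (Suc i) - (Q \<circ> Suc) i" if "i < length ys" for i
        using Cons.prems(3)[of "Suc i"] that by simp
      show "length a = length ys" if "a \<in> tl ` B0" for a
        using that lenB B0 by auto
      obtain a where "a \<in> B0" using B0 by auto
      then show "\<exists>a\<in>tl ` B0. c (k # a) \<noteq> 0"
        using B0_Cons[of a] B0 by (intro bexI[of _ "tl a"]) (auto simp: B_def)
    qed (use B0 in simp)
    ultimately show False by blast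
  qed
  moreover have "(\<Sum>a\<in>B. t a) \<in> carrier ?R"
    using B(1) by (induction B rule: finite_induct) (simp_all add: mpoly_carrier_plus t_carr)
  ultimately show ?case
    using primeideal.I_prime[OF prime0 mpoly_carrier_power[OF y], of "\<Sum>a\<in>B. t a" k]
      power_notin_prime[OF prime0 y y0, of k] unfolding eq mpoly_ring_simps by blast
qed

text \<open>Each exponent is bounded separately, not the total degree, so that the admissible
  monomials fill a box that is easy to count.\<close>

definition exponents_le :: "nat \<Rightarrow> 'k::field mpoly \<Rightarrow> bool" where
  "exponents_le D f \<longleftrightarrow> (\<forall>m\<in>keys f. \<forall>i. lookup m i \<le> D)"

lemma exponents_le_mono: "exponents_le D f \<Longrightarrow> D \<le> D' \<Longrightarrow> exponents_le D' f"
  unfolding exponents_le_def using le_trans by blast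

lemma exponents_le_1: "exponents_le D 1"
  by (simp add: exponents_le_def)

lemma exponents_le_mult:
  assumes "exponents_le D f" "exponents_le D' g"
  shows "exponents_le (D + D') (f * g)"
  unfolding exponents_le_def
proof (intro ballI allI)
  fix m i assume "m \<in> keys (f * g)"
  then obtain a b where ab: "m = a + b" "a \<in> keys f" "b \<in> keys g"
    using keys_mult[of f g] by blast
  have "lookup a i \<le> D" "lookup b i \<le> D'"
    using assms ab unfolding exponents_le_def by blast+
  then show "lookup m i \<le> D + D'" by (simp add: ab(1) lookup_add)
qed

lemma exponents_le_power: "exponents_le D f \<Longrightarrow> exponents_le (k * D) (f ^ k)"
  by (induction k) (simp_all add: exponents_le_1 exponents_le_mult)

lemma exponents_le_power_product:
  assumes "\<And>y. y \<in> set ys \<Longrightarrow> exponents_le D y" "set a \<subseteq> {..N}" "length a = length ys"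
  shows "exponents_le (length ys * (N * D)) (power_product ys a)"
  using assms
proof (induction ys arbitrary: a)
  case (Cons y ys)
  then obtain k b where a: "a = k # b" by (cases a) auto
  have "exponents_le (k * D) (y ^ k)" using Cons.prems(1) by (intro exponents_le_power) simp
  then have "exponents_le (N * D) (y ^ k)"
    by (rule exponents_le_mono) (use Cons.prems(2) a in simp)
  moreover have "exponents_le (length ys * (N * D)) (power_product ys b)"
    using Cons.IH[of b] Cons.prems a by simp
  ultimately show ?case using exponents_le_mult a by fastforce
qed (simp add: exponents_le_1)

lemma exponents_le_exists:
  fixes F :: "'k::field mpoly set"
  assumes "finite F"
  shows "\<exists>D. \<forall>f\<in>F. exponents_le D f"
proof -
  have "\<exists>D. exponents_le D f" for f :: "'k mpoly"
  proof -
    define X where "X = (\<Union>m\<in>keys f. lookup m ` keys m)"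
    have "finite X" by (simp add: X_def)
    have "lookup m i \<le> Max (insert 0 X)" if "m \<in> keys f" for m i
    proof (cases "lookup m i = 0")
      case False
      then have "i \<in> keys m" by (simp add: in_keys_iff)
      then have "lookup m i \<in> X" using that unfolding X_def by blast
      then show ?thesis using \<open>finite X\<close> by simp
    qed simp
    then show ?thesis unfolding exponents_le_def by blast
  qed
  then obtain D where D: "exponents_le (D f) f" for f :: "'k mpoly" by metis
  show ?thesis
  proof (intro exI ballI)
    fix f assume "f \<in> F"
    then have "D f \<le> Max (D ` F)" using assms by simp
    then show "exponents_le (Max (D ` F)) f" using exponents_le_mono D by blast
  qed
qed

lemma card_bounded_monomials:
  "finite {m. keys m \<subseteq> {1..n} \<and> (\<forall>i. lookup m i \<le> M)}"
  "card {m. keys m \<subseteq> {1..n} \<and> (\<forall>i. lookup m i \<le> M)} \<le> Suc M ^ n"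
proof -
  let ?B = "{m. keys m \<subseteq> {1..n} \<and> (\<forall>i. lookup m i \<le> M)}"
  let ?L = "{xs :: nat list. set xs \<subseteq> {..M} \<and> length xs = n}"
  let ?g = "\<lambda>m. map (lookup m) [1..<Suc n]"
  have L: "finite ?L" "card ?L = Suc M ^ n"
    using finite_lists_length_eq[of "{..M}" n] card_lists_length_eq[of "{..M}" n] by simp_all
  have inj: "inj_on ?g ?B"
  proof (rule inj_onI, rule poly_mapping_eqI)
    fix a b i assume a: "a \<in> ?B" and b: "b \<in> ?B" and eq: "?g a = ?g b"
    show "lookup a i = lookup b i"
    proof (cases "i \<in> {1..n}")
      case True
      then show ?thesis using eq by auto
    next
      case False
      then have "i \<notin> keys a" "i \<notin> keys b" using a b by blast+
      then show ?thesis by (simp add: in_keys_iff)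
    qed
  qed
  have sub: "?g ` ?B \<subseteq> ?L" by auto
  show "finite ?B" using inj_on_finite[OF inj sub L(1)] .
  show "card ?B \<le> Suc M ^ n" using card_inj_on_le[OF inj sub L(1)] L(2) by simp
qed

lemma lookup_const_mult: "lookup (single 0 c * f) m = c * lookup f (m :: 'a::monoid_add)"
  for c :: "'k::semiring_0"
  unfolding mult_map_scale_conv_mult[symmetric] by (simp add: map.rep_eq when_def)

text \<open>Otherwise n + 1 elements can be picked from the first n + 1 steps. Their power products
  with exponents up to N number (N + 1)^(n + 1), but they involve at most (M + 1)^n monomials with M
  linear in N. For large N they are linearly dependent, contradicting
  \<open>prime_chain_independent\<close>.\<close>

lemma prime_chain_length_le:
  fixes Q :: "nat \<Rightarrow> 'k::field mpoly set"
  assumes prime: "\<And>i. i \<le> k \<Longrightarrow> primeideal (Q i) (mpoly_ring n)"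
    and chain: "\<And>i. i < k \<Longrightarrow> Q i \<subset> Q (Suc i)"
  shows "k \<le> n"
proof (rule ccontr)
  assume "\<not> k \<le> n"
  then have k: "Suc n \<le> k" by simp
  let ?R = "mpoly_ring n :: 'k mpoly ring"
  have "\<exists>y. y \<in> Q (Suc i) - Q i" if "i < k" for i using chain[OF that] by blast
  then obtain y where y: "y i \<in> Q (Suc i) - Q i" if "i < k" for i by metis
  define ys where "ys = map y [0..<Suc n]"
  have len: "length ys = Suc n" and nth: "ys ! i = y i" if "i < Suc n" for i
    using that by (simp_all add: ys_def del: upt_Suc)
  have ys_carr: "set ys \<subseteq> carrier ?R"
  proof
    fix f assume "f \<in> set ys"
    then obtain i where i: "i < Suc n" "f = y i"
      by (auto simp: ys_def simp del: upt_Suc)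
    have "Suc i \<le> k" using i k by simp
    then show "f \<in> carrier ?R"
      using ideal.Icarr[OF primeideal.axioms(1)[OF prime[of "Suc i"]], of f] y[of i] i by simp
  qed
  obtain D where D: "exponents_le D f" if "f \<in> set ys" for f
    using exponents_le_exists[of "set ys"] by auto
  \<comment> \<open>Chosen so that M + 1 \<le> K (N + 1). With N = K^n this gives (M + 1)^n \<le> N
    (N + 1)^n < (N + 1)^(n + 1).\<close>
  define K where "K = Suc n * D + 1"
  define N where "N = K ^ n"
  define M where "M = length ys * (N * D)"
  define A where "A = {a :: nat list. set a \<subseteq> {..N} \<and> length a = Suc n}"
  define B where "B = {m. keys m \<subseteq> {1..n} \<and> (\<forall>i. lookup m i \<le> M)}"
  have A: "finite A" "card A = Suc N ^ Suc n"
    using finite_lists_length_eq[of "{..N}" "Suc n"] card_lists_length_eq[of "{..N}" "Suc n"]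
    by (simp_all add: A_def)
  have "Suc M \<le> K * Suc N" using len[of 0] by (simp add: M_def K_def algebra_simps)
  then have "Suc M ^ n \<le> (K * Suc N) ^ n" by (rule power_mono) simp
  also have "\<dots> = N * Suc N ^ n" unfolding power_mult_distrib N_def ..
  also have "\<dots> < Suc N ^ Suc n" by simp
  finally have "card B < card A" using card_bounded_monomials(2)[of n M] A by (simp add: B_def)
  moreover have "finite B" unfolding B_def by (rule card_bounded_monomials(1))
  ultimately obtain c where c: "\<exists>a\<in>A. c a \<noteq> 0"
      "\<forall>m\<in>B. (\<Sum>a\<in>A. c a * lookup (power_product ys a) m) = 0"
    using homogeneous_system_solvable[OF _ A(1), of B "\<lambda>a. lookup (power_product ys a)"] by metis
  \<comment> \<open>Coefficients outside the box vanish anyway, so the finitely many equations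
    indexed by \<open>B\<close> express a full polynomial relation.\<close>
  have zero: "lookup (power_product ys a) m = 0" if "a \<in> A" "m \<notin> B" for a m
  proof -
    have "exponents_le M (power_product ys a)"
      unfolding M_def by (rule exponents_le_power_product[OF D]) (use that len[of 0] in \<open>auto simp: A_def\<close>)
    then have "m \<notin> keys (power_product ys a)"
      using power_product_carrier[OF ys_carr, of a] that(2)
      unfolding exponents_le_def B_def mem_carrier_mpoly_ring by blast
    then show ?thesis by (simp add: in_keys_iff)
  qed
  have "(\<Sum>a\<in>A. single 0 (c a) * power_product ys a) = 0"
  proof (rule poly_mapping_eqI)
    fix m
    have "(\<Sum>a\<in>A. c a * lookup (power_product ys a) m) = 0"
      using c(2) zero[of _ m] by (cases "m \<in> B") simp_all
    then show "lookup (\<Sum>a\<in>A. single 0 (c a) * power_product ys a) m = lookup 0 m"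
      by (simp add: lookup_sum lookup_const_mult)
  qed
  moreover have "(\<Sum>a\<in>A. single 0 (c a) * power_product ys a) \<notin> Q 0"
  proof (rule prime_chain_independent)
    show "primeideal (Q i) ?R" if "i \<le> length ys" for i using that prime k len[of 0] by simp
    show "Q i \<subseteq> Q (Suc i)" if "i < length ys" for i using that chain[of i] k len[of 0] by simp
    show "ys ! i \<in> Q (Suc i) - Q i" if "i < length ys" for i
      using that y[of i] nth[of i] k len[of 0] by simp
    show "length a = length ys" if "a \<in> A" for a using that len[of 0] by (simp add: A_def)
  qed (use A c in auto)
  moreover have "0 \<in> Q 0"
    using additive_subgroup.zero_closed[OF ideal.axioms(1)[OF primeideal.axioms(1)[OF prime[of 0]]]]
    by simp
  ultimately show False by simp
qed

section \<open>The height of an ideal generated by variables\<close>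

lemma var_ideal_chain:
  assumes "C \<subseteq> D" "D \<subseteq> {1..n}"
  obtains Q :: "nat \<Rightarrow> 'k::field mpoly set"
  where "Q 0 = var_ideal n C" "Q (card (D - C)) = var_ideal n D"
    "\<And>i. primeideal (Q i) (mpoly_ring n)" "\<And>i. i < card (D - C) \<Longrightarrow> Q i \<subset> Q (Suc i)"
proof -
  have "finite (D - C)" using assms finite_subset[of D "{1..n}"] by simp
  then obtain xs where xs: "set xs = D - C" "distinct xs" using finite_distinct_list by blast
  then have len: "length xs = card (D - C)" using distinct_card by fastforce
  define Q :: "nat \<Rightarrow> 'k mpoly set" where "Q i = var_ideal n (C \<union> set (take i xs))" for i
  show ?thesis
  proof (rule that[of Q])
    show "Q 0 = var_ideal n C" by (simp add: Q_def)
    have "C \<union> (D - C) = D" using assms by blast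
    then show "Q (card (D - C)) = var_ideal n D" by (simp add: Q_def xs flip: len)
    show "primeideal (Q i) (mpoly_ring n)" for i unfolding Q_def by (rule primeideal_var_ideal)
    fix i assume "i < card (D - C)"
    then have i: "i < length xs" by (simp add: len)
    then have take: "set (take (Suc i) xs) = insert (xs ! i) (set (take i xs))"
      by (simp add: take_Suc_conv_app_nth)
    have "xs ! i \<in> D - C" using i xs nth_mem by blast
    moreover have "xs ! i \<notin> set (take i xs)"
      using i xs(2) by (auto simp: in_set_conv_nth nth_eq_iff_index_eq)
    ultimately have "xs ! i \<notin> C \<union> set (take i xs)" "xs ! i \<in> {1..n}" using assms by auto
    then have "\<not> Q (Suc i) \<subseteq> Q i"
      using mpoly_var_mem_var_ideal[of "xs ! i" n "C \<union> set (take i xs)", where 'k = 'k]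
        mpoly_var_mem_var_ideal[of "xs ! i" n "C \<union> set (take (Suc i) xs)", where 'k = 'k]
      unfolding Q_def take by blast
    moreover have "Q i \<subseteq> Q (Suc i)" unfolding Q_def take by (rule var_ideal_mono) blast
    ultimately show "Q i \<subset> Q (Suc i)" by blast
  qed
qed

text \<open>A chain ending here is prolonged by adjoining the n - |C| missing variables, and the
  total length is at most \<open>n\<close>; this bounds the height above. Adjoining the variables of
  \<open>C\<close> one at a time to the zero ideal attains the bound.\<close>

lemma ideal_height_var_ideal:
  assumes C: "C \<subseteq> {1..n}"
  shows "ideal_height (mpoly_ring n) (var_ideal n C :: 'k::field mpoly set) = enat (card C)"
proof -
  let ?R = "mpoly_ring n :: 'k mpoly ring"
  let ?S = "{enat k | k. \<exists>Q :: nat \<Rightarrow> 'k mpoly set. (\<forall>i\<le>k. primeideal (Q i) ?R) \<and>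
     (\<forall>i<k. Q i \<subset> Q (Suc i)) \<and> Q k = var_ideal n C}"
  have "Sup ?S = enat (card C)"
  proof (rule antisym)
    show "Sup ?S \<le> enat (card C)"
    proof (rule Sup_least)
      fix x assume "x \<in> ?S"
      then obtain k and Q :: "nat \<Rightarrow> 'k mpoly set" where x: "x = enat k"
        and Q: "\<And>i. i \<le> k \<Longrightarrow> primeideal (Q i) ?R" "\<And>i. i < k \<Longrightarrow> Q i \<subset> Q (Suc i)"
          "Q k = var_ideal n C"
        by blast
      define l where "l = card ({1..n} - C)"
      obtain Q' :: "nat \<Rightarrow> 'k mpoly set" where Q': "Q' 0 = var_ideal n C"
          "\<And>i. primeideal (Q' i) ?R" "\<And>i. i < l \<Longrightarrow> Q' i \<subset> Q' (Suc i)"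
        using var_ideal_chain[OF C subset_refl, where 'k = 'k] unfolding l_def by metis
      define Q'' where "Q'' i = (if i \<le> k then Q i else Q' (i - k))" for i
      have "k + l \<le> n"
      proof (rule prime_chain_length_le[of "k + l" Q'' n])
        show "primeideal (Q'' i) ?R" for i using Q(1) Q'(2) by (simp add: Q''_def)
        show "Q'' i \<subset> Q'' (Suc i)" if "i < k + l" for i
        proof -
          consider "i < k" | "i = k" | "i > k" by linarith
          then show ?thesis
          proof cases
            case 1
            then show ?thesis using Q(2)[of i] by (simp add: Q''_def)
          next
            case 2
            then show ?thesis using Q'(3)[of 0] Q(3) Q'(1) that by (simp add: Q''_def)
          next
            case 3
            then have "Suc i - k = Suc (i - k)" "i - k < l" using that by simp_all
            then show ?thesis using Q'(3)[of "i - k"] 3 by (simp add: Q''_def)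
          qed
        qed
      qed
      moreover have "l = n - card C"
        unfolding l_def using C by (simp add: card_Diff_subset finite_subset[OF C])
      moreover have "card C \<le> n" using card_mono[OF _ C] by simp
      ultimately show "x \<le> enat (card C)" using x by simp
    qed
    obtain Q :: "nat \<Rightarrow> 'k mpoly set" where "Q (card C) = var_ideal n C"
        "\<And>i. primeideal (Q i) ?R" "\<And>i. i < card C \<Longrightarrow> Q i \<subset> Q (Suc i)"
      using var_ideal_chain[OF empty_subsetI C, where 'k = 'k] by (metis Diff_empty)
    then have "enat (card C) \<in> ?S" by blast
    then show "enat (card C) \<le> Sup ?S" by (rule Sup_upper)
  qed
  then show ?thesis by (simp add: ideal_height_def)
qed

text \<open>All associated primes are minimal, so only the heights n - |S| matter. As |S| \<le> n,
  the truncated subtraction loses no information.\<close>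

theorem unmixed_edge_ideal_iff:
  assumes E: "E \<subseteq> vertex_pairs n"
  shows "unmixed (mpoly_ring n) (edge_ideal n E :: 'k::field mpoly set) \<longleftrightarrow>
    (\<forall>S T. max_indep_set n E S \<and> max_indep_set n E T \<longrightarrow> card S = card T)"
proof -
  let ?R = "mpoly_ring n :: 'k mpoly ring"
  have height: "ideal_height ?R (var_ideal n ({1..n} - S)) = enat (n - card S)" "card S \<le> n"
    if "max_indep_set n E S" for S
  proof -
    have S: "S \<subseteq> {1..n}" by (rule max_indep_set_subset[OF that])
    then have "card ({1..n} - S) = n - card S"
      by (simp add: card_Diff_subset finite_subset[OF S])
    then show "ideal_height ?R (var_ideal n ({1..n} - S)) = enat (n - card S)"
      by (simp add: ideal_height_var_ideal)
    show "card S \<le> n" using card_mono[OF _ S] by simp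
  qed
  have "unmixed ?R (edge_ideal n E) \<longleftrightarrow>
      (\<forall>P\<in>indep_primes n E. \<forall>Q\<in>indep_primes n E. ideal_height ?R P = ideal_height ?R Q)"
    unfolding unmixed_def associated_primes_edge_ideal[OF E]
    using minimal_primes_edge_ideal[OF E, where 'k = 'k] by blast
  also have "\<dots> \<longleftrightarrow> (\<forall>S T. max_indep_set n E S \<and> max_indep_set n E T \<longrightarrow>
      ideal_height ?R (var_ideal n ({1..n} - S)) = ideal_height ?R (var_ideal n ({1..n} - T)))"
    unfolding indep_primes_def by blast
  also have "\<dots> \<longleftrightarrow> (\<forall>S T. max_indep_set n E S \<and> max_indep_set n E T \<longrightarrow> card S = card T)"
  proof -
    have "enat (n - card S) = enat (n - card T) \<longleftrightarrow> card S = card T"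
      if "card S \<le> n" "card T \<le> n" for S T :: "nat set"
      using that by auto
    then show ?thesis using height by metis
  qed
  finally show ?thesis .
qed

section \<open>The second moment method\<close>

lemma finite_vertex_pairs: "finite (vertex_pairs n)"
  by (rule finite_subset[of _ "Pow {1..n}"]) (auto simp: vertex_pairs_def)

lemma set_pmf_gnp: "set_pmf (gnp n p) \<subseteq> Pow (vertex_pairs n)"
  by (auto simp: gnp_def)

lemma finite_set_pmf_gnp: "finite (set_pmf (gnp n p))"
  by (rule finite_subset[OF set_pmf_gnp]) (simp add: finite_vertex_pairs)

text \<open>Prescribing some pairs as present and others as absent is a product event in the
  independent edge indicators, so its probability factors over the pairs.\<close>

lemma prob_gnp_edges:
  assumes p: "0 \<le> p" "p \<le> 1"
    and ST: "S \<subseteq> vertex_pairs n" "T \<subseteq> vertex_pairs n" "S \<inter> T = {}"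
  shows "measure_pmf.prob (gnp n p) {E. S \<subseteq> E \<and> T \<inter> E = {}} = p ^ card S * (1 - p) ^ card T"
proof -
  let ?V = "vertex_pairs n"
  let ?B = "\<lambda>e. if e \<in> S then {True} else if e \<in> T then {False} else UNIV"
  note fin = finite_vertex_pairs[of n]
  have "(\<lambda>X. {e \<in> ?V. X e}) -` {E. S \<subseteq> E \<and> T \<inter> E = {}} = Pi ?V ?B"
    using ST by (auto simp: Pi_def split: if_splits)
  then have "measure_pmf.prob (gnp n p) {E. S \<subseteq> E \<and> T \<inter> E = {}} =
      (\<Prod>e\<in>?V. measure_pmf.prob (bernoulli_pmf p) (?B e))"
    by (simp add: gnp_def measure_Pi_pmf_Pi[OF fin])
  also have "\<dots> = (\<Prod>e\<in>?V. (if e \<in> S then p else 1) * (if e \<in> T then 1 - p else 1))"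
    by (rule prod.cong) (use p ST in \<open>auto simp: measure_pmf_single\<close>)
  also have "\<dots> = p ^ card S * (1 - p) ^ card T"
    using ST by (simp add: prod.distrib prod.If_cases[OF fin] Int_absorb1)
  finally show ?thesis .
qed

text \<open>The common frame of all cases: a deterministic statement outside a bad event
  \<open>B n\<close> whose probability tends to 0. Only actual graphs matter, as the distribution is
  supported on subsets of \<open>vertex_pairs n\<close>.\<close>

lemma gnp_whp_by_bound:
  assumes imp: "eventually (\<lambda>n. \<forall>E \<subseteq> vertex_pairs n. E \<notin> B n \<longrightarrow> A n E) sequentially"
    and bound: "eventually (\<lambda>n. measure_pmf.prob (gnp n (p n)) (B n) \<le> \<epsilon> n) sequentially"
    and lim: "\<epsilon> \<longlonglongrightarrow> 0"
  shows "gnp_whp p A"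
  unfolding gnp_whp_def
proof (rule tendsto_sandwich)
  show "eventually (\<lambda>n. 1 - \<epsilon> n \<le> measure_pmf.prob (gnp n (p n)) {E. A n E}) sequentially"
    using imp bound
  proof eventually_elim
    case (elim n)
    let ?M = "gnp n (p n)"
    have "1 - measure_pmf.prob ?M (B n) = measure_pmf.prob ?M (- B n)"
      using measure_pmf.prob_compl[of "B n" ?M] by (simp add: Compl_eq_Diff_UNIV)
    also have "\<dots> = measure_pmf.prob ?M (- B n \<inter> set_pmf ?M)"
      by (rule measure_Int_set_pmf[symmetric])
    also have "\<dots> \<le> measure_pmf.prob ?M {E. A n E}"
      by (rule measure_pmf.finite_measure_mono) (use elim(1) set_pmf_gnp[of n "p n"] in auto)
    finally show ?case using elim(2) by simp
  qed
  show "(\<lambda>n. 1 - \<epsilon> n) \<longlonglongrightarrow> 1" using tendsto_diff[OF tendsto_const lim, of 1] by simp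
qed auto

lemma prob_UN_le_sum:
  assumes "finite I"
  shows "measure_pmf.prob M (\<Union>i\<in>I. A i) \<le> (\<Sum>i\<in>I. measure_pmf.prob M (A i))"
  by (rule measure_pmf.finite_measure_subadditive_finite[OF assms]) simp

lemma expectation_card:
  assumes "finite I" "finite (set_pmf M)"
  shows "measure_pmf.expectation M (\<lambda>x. real (card {i \<in> I. x \<in> A i})) =
    (\<Sum>i\<in>I. measure_pmf.prob M (A i))"
proof -
  have "real (card {i \<in> I. x \<in> A i}) = (\<Sum>i\<in>I. indicator (A i) x)" for x
    using assms(1) by (simp add: indicator_def sum.If_cases Int_def)
  then show ?thesis
    by (simp add: Bochner_Integration.integral_sum integrable_measure_pmf_finite[OF assms(2)])
qed

lemma markov_pmf:
  fixes f :: "'a \<Rightarrow> real"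
  assumes "finite (set_pmf M)" "\<And>x. f x \<ge> 0" "c > 0"
  shows "measure_pmf.prob M {x. f x \<ge> c} \<le> measure_pmf.expectation M f / c"
proof -
  have "c * measure_pmf.prob M {x. f x \<ge> c} =
      measure_pmf.expectation M (\<lambda>x. c * indicator {x. f x \<ge> c} x)"
    by simp
  also have "\<dots> \<le> measure_pmf.expectation M f"
    by (rule integral_mono)
      (use assms in \<open>auto simp: indicator_def intro: integrable_measure_pmf_finite\<close>)
  finally show ?thesis using assms(3) by (simp add: field_simps)
qed

text \<open>Chebyshev's inequality: the square of the count is the number of ordered pairs of events
  that occur, so the variance is at most \<eta> \<mu>^2, and a deviation of \<mu>/2 gives the factor
  4.\<close>

lemma second_moment:
  assumes "finite I" "finite (set_pmf M)"
    and \<mu>: "\<mu> = (\<Sum>i\<in>I. measure_pmf.prob M (A i))" "\<mu> > 0"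
    and le: "(\<Sum>i\<in>I. \<Sum>j\<in>I. measure_pmf.prob M (A i \<inter> A j)) \<le> (1 + \<eta>) * \<mu>\<^sup>2"
  shows "measure_pmf.prob M {x. real (card {i \<in> I. x \<in> A i}) \<le> \<mu> / 2} \<le> 4 * \<eta>"
proof -
  let ?X = "\<lambda>x. real (card {i \<in> I. x \<in> A i})"
  note int = integrable_measure_pmf_finite[OF assms(2)]
  have X_sq: "(?X x)\<^sup>2 = real (card {ij \<in> I \<times> I. x \<in> A (fst ij) \<inter> A (snd ij)})" for x
  proof -
    have "{ij \<in> I \<times> I. x \<in> A (fst ij) \<inter> A (snd ij)} = {i \<in> I. x \<in> A i} \<times> {i \<in> I. x \<in> A i}"
      by auto
    then show ?thesis by (simp add: card_cartesian_product power2_eq_square)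
  qed
  have EX2: "measure_pmf.expectation M (\<lambda>x. (?X x)\<^sup>2) \<le> (1 + \<eta>) * \<mu>\<^sup>2"
    unfolding X_sq using le assms(1)
    by (subst expectation_card[OF _ assms(2)])
      (simp_all add: sum.cartesian_product case_prod_beta)
  have EX: "measure_pmf.expectation M ?X = \<mu>"
    unfolding \<mu>(1) by (rule expectation_card[OF assms(1,2)])
  have "measure_pmf.expectation M (\<lambda>x. (?X x - \<mu>)\<^sup>2) =
      measure_pmf.expectation M (\<lambda>x. (?X x)\<^sup>2) - 2 * \<mu> * measure_pmf.expectation M ?X + \<mu>\<^sup>2"
    by (simp add: power2_diff int algebra_simps)
  also have "\<dots> \<le> \<eta> * \<mu>\<^sup>2"
    using EX2 unfolding EX by (simp add: algebra_simps power2_eq_square)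
  finally have var: "measure_pmf.expectation M (\<lambda>x. (?X x - \<mu>)\<^sup>2) \<le> \<eta> * \<mu>\<^sup>2" .
  have "measure_pmf.prob M {x. ?X x \<le> \<mu> / 2} \<le> measure_pmf.prob M {x. (?X x - \<mu>)\<^sup>2 \<ge> (\<mu> / 2)\<^sup>2}"
  proof (rule measure_pmf.finite_measure_mono)
    show "{x. ?X x \<le> \<mu> / 2} \<subseteq> {x. (?X x - \<mu>)\<^sup>2 \<ge> (\<mu> / 2)\<^sup>2}"
    proof
      fix x assume "x \<in> {x. ?X x \<le> \<mu> / 2}"
      then have "\<bar>\<mu> / 2\<bar> \<le> \<bar>?X x - \<mu>\<bar>" using \<mu>(2) by simp
      then show "x \<in> {x. (?X x - \<mu>)\<^sup>2 \<ge> (\<mu> / 2)\<^sup>2}" by (simp only: mem_Collect_eq abs_le_square_iff)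
    qed
  qed simp
  also have "\<dots> \<le> measure_pmf.expectation M (\<lambda>x. (?X x - \<mu>)\<^sup>2) / (\<mu> / 2)\<^sup>2"
    by (rule markov_pmf) (use assms in auto)
  also have "\<dots> \<le> \<eta> * \<mu>\<^sup>2 / (\<mu> / 2)\<^sup>2" by (intro divide_right_mono var) simp
  also have "\<dots> = 4 * \<eta>" using \<mu>(2) by (simp add: field_simps power2_eq_square)
  finally show ?thesis .
qed

text \<open>The diagonal pairs contribute \<mu> = \<mu>^2 / \<mu> to the second moment, which is the
  source of the term 1/\<mu>.\<close>

lemma second_moment_almost_independent:
  assumes "finite I" "finite (set_pmf M)"
    and \<mu>: "\<mu> = (\<Sum>i\<in>I. measure_pmf.prob M (A i))" "\<mu> > 0" and "\<eta> \<ge> 0"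
    and le: "\<And>i j. i \<in> I \<Longrightarrow> j \<in> I \<Longrightarrow> i \<noteq> j \<Longrightarrow>
      measure_pmf.prob M (A i \<inter> A j) \<le> (1 + \<eta>) * (measure_pmf.prob M (A i) * measure_pmf.prob M (A j))"
  shows "measure_pmf.prob M {x. \<forall>i\<in>I. x \<notin> A i} \<le> 4 * (1 / \<mu> + \<eta>)"
proof -
  let ?P = "\<lambda>i. measure_pmf.prob M (A i)"
  have "(\<Sum>i\<in>I. \<Sum>j\<in>I. measure_pmf.prob M (A i \<inter> A j)) \<le>
      (\<Sum>i\<in>I. \<Sum>j\<in>I. (if i = j then ?P i else 0) + (1 + \<eta>) * (?P i * ?P j))"
  proof (intro sum_mono)
    fix i j assume "i \<in> I" "j \<in> I"
    then show "measure_pmf.prob M (A i \<inter> A j) \<le> (if i = j then ?P i else 0) + (1 + \<eta>) * (?P i * ?P j)"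
      using le[of i j] \<open>\<eta> \<ge> 0\<close> by auto
  qed
  also have "\<dots> = \<mu> + (1 + \<eta>) * \<mu>\<^sup>2"
    using assms(1)
    by (simp add: sum.distrib \<mu>(1) power2_eq_square sum_product flip: sum_distrib_left)
  also have "\<dots> = (1 + (1 / \<mu> + \<eta>)) * \<mu>\<^sup>2"
    using \<mu>(2) by (simp add: field_simps power2_eq_square)
  finally have "measure_pmf.prob M {x. real (card {i \<in> I. x \<in> A i}) \<le> \<mu> / 2} \<le> 4 * (1 / \<mu> + \<eta>)"
    by (rule second_moment[OF assms(1-4)])
  moreover have "measure_pmf.prob M {x. \<forall>i\<in>I. x \<notin> A i} \<le>
      measure_pmf.prob M {x. real (card {i \<in> I. x \<in> A i}) \<le> \<mu> / 2}"
  proof (rule measure_pmf.finite_measure_mono)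
    show "{x. \<forall>i\<in>I. x \<notin> A i} \<subseteq> {x. real (card {i \<in> I. x \<in> A i}) \<le> \<mu> / 2}"
    proof
      fix x assume "x \<in> {x. \<forall>i\<in>I. x \<notin> A i}"
      then have "{i \<in> I. x \<in> A i} = {}" by blast
      then show "x \<in> {x. real (card {i \<in> I. x \<in> A i}) \<le> \<mu> / 2}"
        using \<mu>(2) by (simp only: mem_Collect_eq card.empty)
    qed
  qed simp
  ultimately show ?thesis by linarith
qed

section \<open>Matchings and complete graphs\<close>

text \<open>The larger set need not be maximal, since extending it to a maximal one only increases
  its size.\<close>

lemma not_unmixed_if:
  assumes E: "E \<subseteq> vertex_pairs n" and S: "max_indep_set n E S"
    and T: "indep_set n E T" and less: "card S < card T"
  shows "\<not> unmixed (mpoly_ring n) (edge_ideal n E :: 'k::field mpoly set)"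
proof -
  obtain U where U: "max_indep_set n E U" "T \<subseteq> U" using indep_set_extends[OF T] .
  have "finite U" using max_indep_set_subset[OF U(1)] by (rule finite_subset) simp
  then have "card S < card U" using less card_mono[OF _ U(2)] by simp
  then show ?thesis unfolding unmixed_edge_ideal_iff[OF E] using S U(1) by (metis less_irrefl)
qed

lemma vertex_pairsE:
  assumes "e \<in> vertex_pairs n"
  obtains u v where "e = {u, v}" "u \<noteq> v" "u \<in> {1..n}" "v \<in> {1..n}"
proof -
  obtain u v where "e = {u, v}" "u \<noteq> v"
    using assms by (auto simp: vertex_pairs_def card_2_iff)
  with assms show ?thesis by (intro that[of u v]) (auto simp: vertex_pairs_def)
qed

lemma vertex_pairs_memE:
  assumes "e \<in> vertex_pairs n" "u \<in> e"
  obtains v where "e = {u, v}" "u \<noteq> v" "u \<in> {1..n}" "v \<in> {1..n}"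
proof -
  obtain x y where "e = {x, y}" "x \<noteq> y" "x \<in> {1..n}" "y \<in> {1..n}"
    using assms(1) by (rule vertex_pairsE)
  with assms(2) show ?thesis by (cases "u = x") (auto intro: that insert_commute)
qed

lemma powr_minus_le_one: "n \<ge> 1 \<Longrightarrow> \<alpha> \<ge> 0 \<Longrightarrow> real n powr (-\<alpha>) \<le> 1"
  by (simp add: powr_minus_divide ge_one_powr_ge_zero)

lemma doubleton_mem_vertex_pairs:
  "{u, v} \<in> vertex_pairs n \<longleftrightarrow> u \<noteq> v \<and> u \<in> {1..n} \<and> v \<in> {1..n}"
  by (auto simp: vertex_pairs_def card_insert_if)

lemma max_indep_set_insert:
  assumes "max_indep_set n E S" "v \<in> {1..n}" "v \<notin> S"
  obtains e where "e \<in> E" "v \<in> e" "e \<subseteq> insert v S"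
proof -
  have "\<not> indep_set n E (insert v S)"
    using assms unfolding max_indep_set_def by blast
  then obtain e where e: "e \<in> E" "e \<subseteq> insert v S"
    using assms(2) max_indep_set_subset[OF assms(1)] by (auto simp: indep_set_def)
  have "\<not> e \<subseteq> S" using assms(1) e(1) by (simp add: max_indep_set_def indep_set_def)
  with e have "v \<in> e" by blast
  with e show ?thesis using that by blast
qed

lemma unmixed_complete:
  assumes "n \<ge> 1"
  shows "unmixed (mpoly_ring n) (edge_ideal n (vertex_pairs n) :: 'k::field mpoly set)"
proof -
  have "card S = 1" if S: "max_indep_set n (vertex_pairs n) S" for S
  proof -
    note Sn = max_indep_set_subset[OF S]
    have "S \<noteq> {}"
    proof
      assume "S = {}"
      moreover have "(1 :: nat) \<in> {1..n}" using assms by simp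
      ultimately obtain e where "e \<in> vertex_pairs n" "e \<subseteq> {1}"
        using max_indep_set_insert[OF S] by blast
      then show False by (auto elim!: vertex_pairsE)
    qed
    then obtain u where u: "u \<in> S" by blast
    have "v = u" if "v \<in> S" for v
    proof (rule ccontr)
      assume "v \<noteq> u"
      then have "{v, u} \<in> vertex_pairs n"
        using that u Sn by (auto simp: doubleton_mem_vertex_pairs)
      moreover have "{v, u} \<subseteq> S" using that u by simp
      ultimately show False using S by (auto simp: max_indep_set_def indep_set_def)
    qed
    then have "S = {u}" using u by blast
    then show ?thesis by simp
  qed
  then show ?thesis unfolding unmixed_edge_ideal_iff[OF subset_refl] by metis
qed

text \<open>Every vertex outside a maximal independent set lies on an edge, and every edge has
  exactly one end outside. So the edges partition the complement into single vertices.\<close>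

lemma unmixed_matching:
  assumes E: "E \<subseteq> vertex_pairs n" and disj: "\<And>e f. e \<in> E \<Longrightarrow> f \<in> E \<Longrightarrow> e \<noteq> f \<Longrightarrow> e \<inter> f = {}"
  shows "unmixed (mpoly_ring n) (edge_ideal n E :: 'k::field mpoly set)"
proof -
  have "finite E" using E finite_vertex_pairs finite_subset by blast
  have "card S = n - card E" if S: "max_indep_set n E S" for S
  proof -
    note Sn = max_indep_set_subset[OF S]
    let ?C = "{1..n} - S"
    have one: "card (e \<inter> ?C) = 1" if e: "e \<in> E" for e
    proof -
      obtain u v where uv: "e = {u, v}" "u \<noteq> v" "u \<in> {1..n}" "v \<in> {1..n}"
        using e E vertex_pairsE by blast
      have "\<not> e \<subseteq> S" using S e by (simp add: max_indep_set_def indep_set_def)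
      \<comment> \<open>If both ends were outside, the edge that blocks \<open>u\<close> from being
        added would have to be \<open>e\<close> itself, whose other end is not in
        \<open>S\<close>.\<close>
      moreover have "u \<in> S \<or> v \<in> S"
      proof (rule ccontr)
        assume *: "\<not> (u \<in> S \<or> v \<in> S)"
        then obtain f where f: "f \<in> E" "u \<in> f" "f \<subseteq> insert u S"
          using max_indep_set_insert[OF S uv(3)] by blast
        then have "f = e" using disj[OF e f(1)] uv(1) by blast
        then show False using f(3) uv(1,2) * by blast
      qed
      ultimately have "e \<inter> ?C = {u} \<or> e \<inter> ?C = {v}" using uv by auto
      then show ?thesis by auto
    qed
    have "?C \<subseteq> (\<Union>e\<in>E. e \<inter> ?C)"
    proof
      fix v assume v: "v \<in> ?C"
      then obtain e where "e \<in> E" "v \<in> e" using max_indep_set_insert[OF S, of v] by blast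
      with v show "v \<in> (\<Union>e\<in>E. e \<inter> ?C)" by blast
    qed
    then have "card ?C = card (\<Union>e\<in>E. e \<inter> ?C)" by (metis (no_types, lifting) Int_lower2 UN_least subset_antisym)
    also have "\<dots> = (\<Sum>e\<in>E. card (e \<inter> ?C))"
      by (rule card_UN_disjoint) (use \<open>finite E\<close> disj in blast)+
    also have "\<dots> = card E" using one by simp
    finally have "card ?C = card E" .
    moreover have "card ?C = n - card S"
      using Sn by (simp add: card_Diff_subset finite_subset[OF Sn])
    moreover have "card S \<le> n" using card_mono[OF _ Sn] by simp
    ultimately show ?thesis by simp
  qed
  then show ?thesis unfolding unmixed_edge_ideal_iff[OF E] by metis
qed

lemma card_vertex_pairs_le: "card (vertex_pairs n) \<le> n ^ 2"
proof -
  have "vertex_pairs n \<subseteq> (\<lambda>(u, v). {u, v}) ` ({1..n} \<times> {1..n})"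
    by (auto elim!: vertex_pairsE)
  then have "card (vertex_pairs n) \<le> card ({1..n} \<times> {1..n})"
    by (meson card_image_le card_mono finite_SigmaI finite_atLeastAtMost finite_imageI le_trans)
  then show ?thesis by (simp add: power2_eq_square)
qed

section \<open>Union bounds for the very dense and the very sparse range\<close>

lemma whp_unmixed_very_dense:
  assumes "\<alpha> > 2"
  shows "gnp_whp (\<lambda>n. 1 - real n powr (-\<alpha>))
    (\<lambda>n E. unmixed (mpoly_ring n) (edge_ideal n E :: 'k::field mpoly set))"
proof (rule gnp_whp_by_bound)
  let ?p = "\<lambda>n. 1 - real n powr (-\<alpha>)"
  let ?B = "\<lambda>n. \<Union>e\<in>vertex_pairs n. {E. {} \<subseteq> E \<and> {e} \<inter> E = {}}"
  show "eventually (\<lambda>n. \<forall>E \<subseteq> vertex_pairs n. E \<notin> ?B n \<longrightarrow>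
      unmixed (mpoly_ring n) (edge_ideal n E :: 'k mpoly set)) sequentially"
    using eventually_ge_at_top[of 1]
  proof eventually_elim
    case (elim n)
    show ?case
    proof (intro allI impI)
      fix E assume "E \<subseteq> vertex_pairs n" "E \<notin> ?B n"
      then have "E = vertex_pairs n" by blast
      then show "unmixed (mpoly_ring n) (edge_ideal n E :: 'k mpoly set)"
        using unmixed_complete[OF elim] by simp
    qed
  qed
  show "eventually (\<lambda>n. measure_pmf.prob (gnp n (?p n)) (?B n) \<le> real n ^ 2 * real n powr (-\<alpha>)) sequentially"
    using eventually_ge_at_top[of 1]
  proof eventually_elim
    case (elim n)
    have "real n powr (-\<alpha>) \<le> 1" using elim assms by (simp add: powr_minus_le_one)
    then have p: "0 \<le> ?p n" "?p n \<le> 1" by auto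
    have "measure_pmf.prob (gnp n (?p n)) (?B n) \<le>
        (\<Sum>e\<in>vertex_pairs n. measure_pmf.prob (gnp n (?p n)) {E. {} \<subseteq> E \<and> {e} \<inter> E = {}})"
      by (rule prob_UN_le_sum[OF finite_vertex_pairs])
    also have "\<dots> = (\<Sum>e\<in>vertex_pairs n. real n powr (-\<alpha>))"
    proof (rule sum.cong)
      fix e assume "e \<in> vertex_pairs n"
      then show "measure_pmf.prob (gnp n (?p n)) {E. {} \<subseteq> E \<and> {e} \<inter> E = {}} = real n powr (-\<alpha>)"
        by (subst prob_gnp_edges[OF p]) simp_all
    qed simp
    also have "\<dots> \<le> real (n ^ 2) * real n powr (-\<alpha>)"
      using card_vertex_pairs_le[of n] unfolding sum_constant by (intro mult_right_mono) (simp_all only: of_nat_le_iff, simp)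
    finally show ?case by simp
  qed
  show "(\<lambda>n. real n ^ 2 * real n powr (-\<alpha>)) \<longlonglongrightarrow> 0" using assms by real_asymp
qed

text \<open>A pair of adjacent edges is determined by a common vertex and two other ends. So the
  expected number of such pairs is at most n^3 p^2 = n^(3 - 2\<alpha>), and without them the graph
  is a matching.\<close>

lemma whp_unmixed_very_sparse:
  assumes "3 / 2 < \<alpha>"
  shows "gnp_whp (\<lambda>n. real n powr (-\<alpha>))
    (\<lambda>n E. unmixed (mpoly_ring n) (edge_ideal n E :: 'k::field mpoly set))"
proof (rule gnp_whp_by_bound)
  let ?p = "\<lambda>n. real n powr (-\<alpha>)"
  define I where "I n = {(e, f). e \<in> vertex_pairs n \<and> f \<in> vertex_pairs n \<and> e \<noteq> f \<and> e \<inter> f \<noteq> {}}" for n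
  let ?B = "\<lambda>n. \<Union>ef\<in>I n. {E. {fst ef, snd ef} \<subseteq> E \<and> {} \<inter> E = {}}"
  have "unmixed (mpoly_ring n) (edge_ideal n E :: 'k mpoly set)"
    if "E \<subseteq> vertex_pairs n" "E \<notin> ?B n" for n E
  proof (rule unmixed_matching[OF that(1)])
    fix e f assume "e \<in> E" "f \<in> E" "e \<noteq> f"
    then show "e \<inter> f = {}" using that by (auto simp: I_def)
  qed
  then show "eventually (\<lambda>n. \<forall>E \<subseteq> vertex_pairs n. E \<notin> ?B n \<longrightarrow>
      unmixed (mpoly_ring n) (edge_ideal n E :: 'k mpoly set)) sequentially"
    by simp
  have I_sub: "I n \<subseteq> (\<lambda>(u, v, w). ({u, v}, {u, w})) ` ({1..n} \<times> {1..n} \<times> {1..n})" for n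
  proof
    fix ef assume "ef \<in> I n"
    then obtain e f u where ef: "ef = (e, f)" "e \<in> vertex_pairs n" "f \<in> vertex_pairs n" "u \<in> e" "u \<in> f"
      by (auto simp: I_def)
    obtain v where v: "e = {u, v}" "v \<in> {1..n}" "u \<in> {1..n}"
      using ef(2,4) by (rule vertex_pairs_memE)
    obtain w where w: "f = {u, w}" "w \<in> {1..n}"
      using ef(3,5) by (rule vertex_pairs_memE)
    show "ef \<in> (\<lambda>(u, v, w). ({u, v}, {u, w})) ` ({1..n} \<times> {1..n} \<times> {1..n})"
      using v w ef(1) by (intro image_eqI[of _ _ "(u, v, w)"]) auto
  qed
  have finI: "finite (I n)" for n by (rule finite_subset[OF I_sub]) simp
  have cardI: "card (I n) \<le> n ^ 3" for n
  proof -
    have "card (I n) \<le> card ({1..n} \<times> {1..n} \<times> {1..n})"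
      by (rule surj_card_le[OF _ I_sub]) simp
    also have "\<dots> = n ^ 3" by (simp add: power3_eq_cube card_cartesian_product)
    finally show ?thesis .
  qed
  show "eventually (\<lambda>n. measure_pmf.prob (gnp n (?p n)) (?B n) \<le> real n ^ 3 * (real n powr (-\<alpha>)) ^ 2) sequentially"
    using eventually_ge_at_top[of 1]
  proof eventually_elim
    case (elim n)
    have "?p n \<le> 1" using elim assms by (simp add: powr_minus_le_one)
    then have p: "0 \<le> ?p n" "?p n \<le> 1" by auto
    have "measure_pmf.prob (gnp n (?p n)) (?B n) \<le>
        (\<Sum>ef\<in>I n. measure_pmf.prob (gnp n (?p n)) {E. {fst ef, snd ef} \<subseteq> E \<and> {} \<inter> E = {}})"
      by (rule prob_UN_le_sum[OF finI])
    also have "\<dots> = (\<Sum>ef\<in>I n. ?p n ^ 2)"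
    proof (rule sum.cong)
      fix ef assume "ef \<in> I n"
      then have "{fst ef, snd ef} \<subseteq> vertex_pairs n" and "fst ef \<noteq> snd ef"
        by (auto simp only: I_def fst_conv snd_conv split: prod.splits)
      moreover from this have "card {fst ef, snd ef} = 2" by simp
      ultimately show "measure_pmf.prob (gnp n (?p n)) {E. {fst ef, snd ef} \<subseteq> E \<and> {} \<inter> E = {}} = ?p n ^ 2"
        by (subst prob_gnp_edges[OF p]) (simp_all add: power2_eq_square)
    qed simp
    also have "\<dots> \<le> real (n ^ 3) * ?p n ^ 2"
      using cardI[of n] unfolding sum_constant by (intro mult_right_mono) (simp_all only: of_nat_le_iff, simp)
    finally show ?case by simp
  qed
  show "(\<lambda>n. real n ^ 3 * (real n powr (-\<alpha>)) ^ 2) \<longlonglongrightarrow> 0" using assms by real_asymp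
qed

section \<open>Isolated paths\<close>

text \<open>Turns a bound \<open>c\<close> on the overlap of two sets of prescribed pairs into a
  correlation factor x^(-c), the form needed for the second moment.\<close>

lemma power_card_Un:
  fixes x :: real
  assumes "finite A" "finite B" "card (A \<inter> B) \<le> c" "0 < x" "x \<le> 1"
  shows "x ^ card (A \<union> B) \<le> x ^ card A * x ^ card B / x ^ c"
proof -
  have "x ^ card (A \<union> B) * x ^ c \<le> x ^ card (A \<union> B) * x ^ card (A \<inter> B)"
    using assms by (intro mult_left_mono power_decreasing) auto
  also have "\<dots> = x ^ card A * x ^ card B"
    by (simp add: card_Un_Int[OF assms(1,2)] flip: power_add)
  finally show ?thesis using assms(4) by (simp add: field_simps)
qed

text \<open>A component of the graph that is a path on three vertices, given by its
  centre \<open>b\<close> and its pair \<open>D\<close> of end vertices.\<close>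

definition path_edges :: "nat \<Rightarrow> nat set \<Rightarrow> nat set set" where
  "path_edges b D = (\<lambda>d. {b, d}) ` D"

text \<open>For a valid index the pair \<open>D\<close> of end vertices is among these, which
  excludes triangles.\<close>

definition path_nonedges :: "nat \<Rightarrow> nat \<Rightarrow> nat set \<Rightarrow> nat set set" where
  "path_nonedges n b D = {e \<in> vertex_pairs n. e \<inter> insert b D \<noteq> {}} - path_edges b D"

definition isolated_path :: "nat \<Rightarrow> nat \<Rightarrow> nat set \<Rightarrow> nat set set set" where
  "isolated_path n b D = {E. path_edges b D \<subseteq> E \<and> path_nonedges n b D \<inter> E = {}}"

text \<open>The ends form an unordered set so that each path is counted once.\<close>

definition path_indices :: "nat \<Rightarrow> (nat \<times> nat set) set" where
  "path_indices n = (SIGMA b : {1..n}. {D. D \<subseteq> {1..n} - {b} \<and> card D = 2})"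

lemma isolated_path_edge:
  assumes "E \<in> isolated_path n b D" "E \<subseteq> vertex_pairs n" "e \<in> E" "e \<inter> insert b D \<noteq> {}"
  shows "e \<in> path_edges b D"
  using assms unfolding isolated_path_def path_nonedges_def by blast

text \<open>Extend the centre to a maximal independent set; it contains neither end. Exchanging the
  centre for both ends keeps independence, because every edge at the component passes through the
  centre, and gains one vertex.\<close>

lemma not_unmixed_isolated_path:
  assumes E: "E \<subseteq> vertex_pairs n" and bD: "(b, D) \<in> path_indices n"
    and comp: "E \<in> isolated_path n b D"
  shows "\<not> unmixed (mpoly_ring n) (edge_ideal n E :: 'k::field mpoly set)"
proof -
  have b: "b \<in> {1..n}" "D \<subseteq> {1..n}" "b \<notin> D" "card D = 2"
    using bD by (auto simp: path_indices_def)
  have edges: "path_edges b D \<subseteq> E" using comp by (simp add: isolated_path_def)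
  have nonsub: "\<not> e \<subseteq> {b}" if "e \<in> E" for e
    using that E by (auto simp: vertex_pairs_def dest!: subset_singletonD)
  then have "indep_set n E {b}" using b(1) by (simp add: indep_set_def)
  then obtain S where S: "max_indep_set n E S" "{b} \<subseteq> S" by (rule indep_set_extends)
  have S_ind: "\<And>e. e \<in> E \<Longrightarrow> \<not> e \<subseteq> S" and Sn: "S \<subseteq> {1..n}"
    using S(1) by (simp_all add: max_indep_set_def indep_set_def)
  have "finite S" "finite D" using Sn b(2) finite_subset by blast+
  have SD: "S \<inter> D = {}"
  proof (rule ccontr)
    assume "S \<inter> D \<noteq> {}"
    then obtain d where "d \<in> S" "d \<in> D" by blast
    then have "{b, d} \<in> E" "{b, d} \<subseteq> S" using edges S(2) by (auto simp: path_edges_def)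
    then show False using S_ind by blast
  qed
  let ?T = "(S - {b}) \<union> D"
  have "\<not> e \<subseteq> ?T" if e: "e \<in> E" for e
  proof (cases "e \<inter> insert b D = {}")
    case True
    then show ?thesis using S_ind[OF e] by blast
  next
    case False
    then have "b \<in> e" using isolated_path_edge[OF comp E e] by (auto simp: path_edges_def)
    then show ?thesis using b(3) by blast
  qed
  then have T: "indep_set n E ?T" using Sn b(2) by (auto simp: indep_set_def)
  have "card ?T = card (S - {b}) + card D"
    by (rule card_Un_disjoint) (use \<open>finite S\<close> \<open>finite D\<close> SD in auto)
  moreover have "card S = Suc (card (S - {b}))"
    by (rule card.remove) (use \<open>finite S\<close> S(2) in auto)
  ultimately have "card S < card ?T" using b(4) by simp
  then show ?thesis by (rule not_unmixed_if[OF E S(1) T])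
qed

text \<open>Components that share a vertex coincide, so in the second moment only vertex-disjoint
  paths have positive joint probability.\<close>

lemma isolated_path_disjoint:
  assumes i: "(b, D) \<in> path_indices n" and j: "(b', D') \<in> path_indices n"
    and ne: "(b, D) \<noteq> (b', D')" and meet: "insert b D \<inter> insert b' D' \<noteq> {}"
    and E: "E \<subseteq> vertex_pairs n" "E \<in> isolated_path n b D"
  shows "E \<notin> isolated_path n b' D'"
proof
  assume E': "E \<in> isolated_path n b' D'"
  have D: "b \<notin> D" "card D = 2" "b' \<notin> D'" "card D' = 2"
    using i j by (auto simp: path_indices_def)
  have fin: "finite D" "finite D'" using D by (simp_all add: card_ge_0_finite)
  have edge: "{b, d} \<in> E" "{b', d'} \<in> E" if "d \<in> D" "d' \<in> D'" for d d'
    using E(2) E' that by (auto simp: isolated_path_def path_edges_def)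
  have in_path: "b \<in> {b', d'} \<and> {b', d'} \<subseteq> insert b D" if "d' \<in> D'" "b' \<in> insert b D \<or> d' \<in> insert b D" for d'
  proof -
    have "d' \<in> D' \<and> {b', d'} \<in> E" using E' that by (auto simp: isolated_path_def path_edges_def)
    then have "{b', d'} \<in> path_edges b D"
      using isolated_path_edge[OF E(2,1), of "{b', d'}"] that by blast
    then show ?thesis by (auto simp: path_edges_def)
  qed
  have "b' \<in> insert b D"
  proof (rule ccontr)
    assume "b' \<notin> insert b D"
    moreover from this obtain d' where "d' \<in> D'" "d' \<in> insert b D" using meet by blast
    ultimately show False using in_path by blast
  qed
  then have sub: "d' \<in> D' \<Longrightarrow> b \<in> {b', d'} \<and> {b', d'} \<subseteq> insert b D" for d' using in_path by blast
  \<comment> \<open>Each edge of the second path is an edge of the first and so contains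
    \<open>b\<close>. If \<open>b\<close> were not the second centre, it would be the only end
    vertex of the second path.\<close>
  have "b = b'"
  proof (rule ccontr)
    assume "b \<noteq> b'"
    then have "D' \<subseteq> {b}" using sub by blast
    then have "card D' \<le> 1" using card_mono[of "{b}" D'] by simp
    then show False using D by simp
  qed
  moreover from this have "D' \<subseteq> D" using sub D by blast
  then have "D' = D" using card_subset_eq[OF fin(1)] D by simp
  ultimately show False using ne by simp
qed

lemma card_pairs_meeting:
  assumes "finite K"
  shows "card {e \<in> vertex_pairs n. e \<inter> K \<noteq> {}} \<le> card K * n"
proof -
  have "{e \<in> vertex_pairs n. e \<inter> K \<noteq> {}} \<subseteq> (\<lambda>(u, v). {u, v}) ` (K \<times> {1..n})"
  proof
    fix e assume "e \<in> {e \<in> vertex_pairs n. e \<inter> K \<noteq> {}}"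
    then obtain u where u: "e \<in> vertex_pairs n" "u \<in> e" "u \<in> K" by blast
    obtain v where "e = {u, v}" "v \<in> {1..n}" using u(1,2) by (rule vertex_pairs_memE)
    with u(3) show "e \<in> (\<lambda>(u, v). {u, v}) ` (K \<times> {1..n})"
      by (intro image_eqI[of _ _ "(u, v)"]) auto
  qed
  then have "card {e \<in> vertex_pairs n. e \<inter> K \<noteq> {}} \<le> card (K \<times> {1..n})"
    by (rule surj_card_le[rotated]) (use assms in simp)
  then show ?thesis by (simp add: card_cartesian_product)
qed

lemma card_pairs_meeting_both:
  assumes "finite K" "finite L" "K \<inter> L = {}"
  shows "card {e \<in> vertex_pairs n. e \<inter> K \<noteq> {} \<and> e \<inter> L \<noteq> {}} \<le> card K * card L"
proof -
  have "{e \<in> vertex_pairs n. e \<inter> K \<noteq> {} \<and> e \<inter> L \<noteq> {}} \<subseteq> (\<lambda>(u, v). {u, v}) ` (K \<times> L)"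
  proof
    fix e assume e: "e \<in> {e \<in> vertex_pairs n. e \<inter> K \<noteq> {} \<and> e \<inter> L \<noteq> {}}"
    then obtain u where u: "e \<in> vertex_pairs n" "u \<in> e" "u \<in> K" by blast
    obtain v where v: "e = {u, v}" "v \<in> {1..n}" using u(1,2) by (rule vertex_pairs_memE)
    then have "v \<in> L" using e u(3) assms(3) by blast
    with u(3) v show "e \<in> (\<lambda>(u, v). {u, v}) ` (K \<times> L)"
      by (intro image_eqI[of _ _ "(u, v)"]) auto
  qed
  then have "card {e \<in> vertex_pairs n. e \<inter> K \<noteq> {} \<and> e \<inter> L \<noteq> {}} \<le> card (K \<times> L)"
    by (rule surj_card_le[rotated]) (use assms in simp)
  then show ?thesis by (simp add: card_cartesian_product)
qed

lemma path_indices_facts: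
  assumes "(b, D) \<in> path_indices n"
  shows "finite (insert b D)" "card (insert b D) = 3" "path_edges b D \<subseteq> vertex_pairs n"
    "card (path_edges b D) = 2" "path_nonedges n b D \<subseteq> vertex_pairs n"
    "path_edges b D \<inter> path_nonedges n b D = {}" "card (path_nonedges n b D) \<le> 3 * n"
proof -
  have D: "b \<in> {1..n}" "D \<subseteq> {1..n}" "b \<notin> D" "card D = 2"
    using assms by (auto simp: path_indices_def)
  then have fin: "finite D" by (simp add: card_ge_0_finite)
  then show *: "finite (insert b D)" "card (insert b D) = 3" using D by simp_all
  show "path_edges b D \<subseteq> vertex_pairs n"
    using D by (auto simp: path_edges_def doubleton_mem_vertex_pairs)
  have "inj_on (\<lambda>d. {b, d}) D" by (auto intro!: inj_onI simp: doubleton_eq_iff)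
  then show "card (path_edges b D) = 2" using D by (simp add: path_edges_def card_image)
  show "path_nonedges n b D \<subseteq> vertex_pairs n" "path_edges b D \<inter> path_nonedges n b D = {}"
    by (auto simp: path_nonedges_def)
  have "card (path_nonedges n b D) \<le> card {e \<in> vertex_pairs n. e \<inter> insert b D \<noteq> {}}"
    by (rule card_mono) (auto simp: path_nonedges_def finite_vertex_pairs)
  also have "\<dots> \<le> 3 * n" using card_pairs_meeting[OF *(1), of n] *(2) by simp
  finally show "card (path_nonedges n b D) \<le> 3 * n" .
qed

lemma prob_isolated_path:
  assumes "(b, D) \<in> path_indices n" "0 \<le> p" "p \<le> 1"
  shows "measure_pmf.prob (gnp n p) (isolated_path n b D) =
    p ^ 2 * (1 - p) ^ card (path_nonedges n b D)"
  unfolding isolated_path_def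
  by (subst prob_gnp_edges) (simp_all add: assms path_indices_facts[OF assms(1)])

text \<open>For vertex-disjoint paths the only dependence comes from pairs required absent by both
  events. These join the two triples of vertices, so there are at most 9.\<close>

lemma prob_isolated_path_pair:
  assumes i: "(b, D) \<in> path_indices n" and j: "(b', D') \<in> path_indices n"
    and ne: "(b, D) \<noteq> (b', D')" and p: "0 \<le> p" "p < 1"
  shows "measure_pmf.prob (gnp n p) (isolated_path n b D \<inter> isolated_path n b' D') \<le>
    1 / (1 - p) ^ 9 * (measure_pmf.prob (gnp n p) (isolated_path n b D) *
      measure_pmf.prob (gnp n p) (isolated_path n b' D'))"
proof (cases "insert b D \<inter> insert b' D' = {}")
  case False
  have "measure_pmf.prob (gnp n p) (isolated_path n b D \<inter> isolated_path n b' D') =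
      measure_pmf.prob (gnp n p) (isolated_path n b D \<inter> isolated_path n b' D' \<inter> set_pmf (gnp n p))"
    by (rule measure_Int_set_pmf[symmetric])
  also have "isolated_path n b D \<inter> isolated_path n b' D' \<inter> set_pmf (gnp n p) = {}"
    using isolated_path_disjoint[OF i j ne False] set_pmf_gnp by blast
  finally show ?thesis using p by simp
next
  case True
  let ?S = "path_edges b D" and ?S' = "path_edges b' D'"
  let ?T = "path_nonedges n b D" and ?T' = "path_nonedges n b' D'"
  note f = path_indices_facts[OF i] and f' = path_indices_facts[OF j]
  have fin: "finite ?T" "finite ?T'" "finite ?S" "finite ?S'"
    using finite_subset[OF _ finite_vertex_pairs] f(3,5) f'(3,5) by simp_all
  have in_path: "e \<inter> insert b' D' = {}" if "e \<in> ?S" for e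
    using that True by (auto simp: path_edges_def)
  have in_path': "e \<inter> insert b D = {}" if "e \<in> ?S'" for e
    using that True by (auto simp: path_edges_def)
  have S_ne: "e \<inter> insert b D \<noteq> {}" if "e \<in> ?S" for e using that by (auto simp: path_edges_def)
  have "?S \<inter> ?S' = {}" using in_path' S_ne by blast
  then have card_S: "card (?S \<union> ?S') = 4"
    using fin f(4) f'(4) by (simp add: card_Un_disjoint)
  have cross: "(?S \<union> ?S') \<inter> (?T \<union> ?T') = {}"
    using in_path in_path' f(6) f'(6) unfolding path_nonedges_def by blast
  have "?T \<inter> ?T' \<subseteq> {e \<in> vertex_pairs n. e \<inter> insert b D \<noteq> {} \<and> e \<inter> insert b' D' \<noteq> {}}"
    unfolding path_nonedges_def by blast
  then have "card (?T \<inter> ?T') \<le>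
      card {e \<in> vertex_pairs n. e \<inter> insert b D \<noteq> {} \<and> e \<inter> insert b' D' \<noteq> {}}"
    by (rule card_mono[rotated]) (simp add: finite_vertex_pairs)
  also have "\<dots> \<le> 9"
    using card_pairs_meeting_both[OF f(1) f'(1) True, of n] f(2) f'(2) by simp
  finally have le9: "card (?T \<inter> ?T') \<le> 9" .
  have "isolated_path n b D \<inter> isolated_path n b' D' =
      {E. ?S \<union> ?S' \<subseteq> E \<and> (?T \<union> ?T') \<inter> E = {}}"
    unfolding isolated_path_def by blast
  moreover have "measure_pmf.prob (gnp n p) {E. ?S \<union> ?S' \<subseteq> E \<and> (?T \<union> ?T') \<inter> E = {}} =
      p ^ card (?S \<union> ?S') * (1 - p) ^ card (?T \<union> ?T')"
    by (rule prob_gnp_edges) (use cross f(3,5) f'(3,5) p in simp_all)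
  ultimately have "measure_pmf.prob (gnp n p) (isolated_path n b D \<inter> isolated_path n b' D') =
      p ^ 4 * (1 - p) ^ card (?T \<union> ?T')"
    by (simp only: card_S)
  also have "\<dots> \<le> p ^ 4 * ((1 - p) ^ card ?T * (1 - p) ^ card ?T' / (1 - p) ^ 9)"
    using p by (intro mult_left_mono power_card_Un fin le9) simp_all
  also have "\<dots> = 1 / (1 - p) ^ 9 * (p ^ 2 * (1 - p) ^ card ?T * (p ^ 2 * (1 - p) ^ card ?T'))"
    by (simp add: field_simps flip: power_add)
  finally show ?thesis using p by (simp add: prob_isolated_path[OF i] prob_isolated_path[OF j])
qed

lemma card_path_indices: "finite (path_indices n)" "card (path_indices n) = n * ((n - 1) choose 2)"
proof -
  have "finite {D. D \<subseteq> {1..n} - {b} \<and> card D = 2}" for b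
    by (rule finite_subset[of _ "Pow {1..n}"]) auto
  moreover have "card {D. D \<subseteq> {1..n} - {b} \<and> card D = 2} = (n - 1) choose 2" if "b \<in> {1..n}" for b
    using that by (subst n_subsets) simp_all
  ultimately show "finite (path_indices n)" "card (path_indices n) = n * ((n - 1) choose 2)"
    unfolding path_indices_def by (auto simp: card_SigmaI)
qed

lemma real_choose_two: "real (n choose 2) = real n * (real n - 1) / 2"
proof (cases n)
  case (Suc m)
  have "2 dvd n * (n - 1)" by (cases "even n") auto
  then show ?thesis using Suc by (simp add: choose_two real_of_nat_div algebra_simps)
qed simp

text \<open>As p \<le> 1/n, a path is isolated with probability bounded below once its edges are
  present. The mean is therefore of order n^3 p^2 = n^(3 - 2\<alpha>), which diverges for \<alpha> <
  3/2.\<close>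

lemma whp_not_unmixed_sparse:
  assumes \<alpha>: "1 \<le> \<alpha>" "\<alpha> < 3 / 2"
  shows "gnp_whp (\<lambda>n. real n powr (-\<alpha>))
    (\<lambda>n E. \<not> unmixed (mpoly_ring n) (edge_ideal n E :: 'k::field mpoly set))"
proof (rule gnp_whp_by_bound)
  let ?p = "\<lambda>n. real n powr (-\<alpha>)"
  let ?B = "\<lambda>n. {E. \<forall>i\<in>path_indices n. E \<notin> isolated_path n (fst i) (snd i)}"
  show "eventually (\<lambda>n. \<forall>E \<subseteq> vertex_pairs n. E \<notin> ?B n \<longrightarrow>
      \<not> unmixed (mpoly_ring n) (edge_ideal n E :: 'k mpoly set)) sequentially"
  proof (intro always_eventually allI impI)
    fix n E assume E: "E \<subseteq> vertex_pairs n" "E \<notin> ?B n"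
    then obtain b D where bD: "(b, D) \<in> path_indices n" "E \<in> isolated_path n b D" by auto
    show "\<not> unmixed (mpoly_ring n) (edge_ideal n E :: 'k mpoly set)"
      by (rule not_unmixed_isolated_path[OF E(1) bD])
  qed
  \<comment> \<open>A lower bound for the mean: the number of paths times p^2, with p replaced by
    1/n in the isolation factor and at most 3n absent pairs.\<close>
  let ?m = "\<lambda>n. real n * ((real n - 1) * (real n - 2) / 2) * (real n powr (-\<alpha>)) ^ 2 * (1 - 1 / real n) ^ (3 * n)"
  let ?e = "\<lambda>n. 4 * (1 / ?m n + (1 / (1 - 1 / real n) ^ 9 - 1))"
  show "eventually (\<lambda>n. measure_pmf.prob (gnp n (?p n)) (?B n) \<le> ?e n) sequentially"
    using eventually_ge_at_top[of 3]
  proof eventually_elim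
    case (elim n)
    define p where "p = ?p n"
    have "?p n \<le> real n powr (-1)" using elim \<alpha> by (intro powr_mono) simp_all
    then have p_le: "p \<le> 1 / real n" using elim by (simp add: p_def powr_minus_divide)
    moreover have "1 / real n < 1" using elim by simp
    ultimately have p: "p < 1" "0 < p" "0 \<le> p" using elim by (linarith, simp_all add: p_def)
    define \<mu> where "\<mu> = (\<Sum>i\<in>path_indices n. measure_pmf.prob (gnp n p) (isolated_path n (fst i) (snd i)))"
    have "?m n = real (card (path_indices n)) * (p ^ 2 * (1 - 1 / real n) ^ (3 * n))"
    proof -
      have "real ((n - 1) choose 2) = (real n - 1) * (real n - 2) / 2"
        using elim by (simp add: real_choose_two of_nat_diff)
      then show ?thesis by (simp add: card_path_indices(2) p_def mult_ac)
    qed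
    also have "\<dots> = (\<Sum>i\<in>path_indices n. p ^ 2 * (1 - 1 / real n) ^ (3 * n))" by simp
    also have "\<dots> \<le> \<mu>"
      unfolding \<mu>_def
    proof (rule sum_mono)
      fix i assume i: "i \<in> path_indices n"
      then have i': "(fst i, snd i) \<in> path_indices n" by simp
      have "(1 - 1 / real n) ^ (3 * n) \<le> (1 - p) ^ (3 * n)"
        using p_le elim by (intro power_mono) simp_all
      also have "\<dots> \<le> (1 - p) ^ card (path_nonedges n (fst i) (snd i))"
        using p path_indices_facts(7)[OF i'] by (intro power_decreasing) simp_all
      finally show "p ^ 2 * (1 - 1 / real n) ^ (3 * n) \<le>
          measure_pmf.prob (gnp n p) (isolated_path n (fst i) (snd i))"
        using p prob_isolated_path[OF i', of p] by (simp add: mult_left_mono)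
    qed
    finally have m_le: "?m n \<le> \<mu>" .
    have m_pos: "?m n > 0" using elim by simp
    have "measure_pmf.prob (gnp n p) (?B n) \<le> 4 * (1 / \<mu> + (1 / (1 - p) ^ 9 - 1))"
    proof (rule second_moment_almost_independent[OF card_path_indices(1) finite_set_pmf_gnp \<mu>_def])
      show "\<mu> > 0" using m_le m_pos by linarith
      have "(1 - p) ^ 9 \<le> 1" using p by (intro power_le_one) simp_all
      then show "0 \<le> 1 / (1 - p) ^ 9 - 1" using p by simp
    next
      fix i j assume "i \<in> path_indices n" "j \<in> path_indices n" "i \<noteq> j"
      then show "measure_pmf.prob (gnp n p) (isolated_path n (fst i) (snd i) \<inter> isolated_path n (fst j) (snd j))
          \<le> (1 + (1 / (1 - p) ^ 9 - 1)) * (measure_pmf.prob (gnp n p) (isolated_path n (fst i) (snd i)) *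
             measure_pmf.prob (gnp n p) (isolated_path n (fst j) (snd j)))"
        using prob_isolated_path_pair[of "fst i" "snd i" n "fst j" "snd j" p] p
        by (simp add: prod_eq_iff)
    qed
    also have "\<dots> \<le> ?e n"
    proof -
      have "1 / \<mu> \<le> 1 / ?m n" using m_le m_pos by (intro divide_left_mono) simp_all
      moreover have "(1 - 1 / real n) ^ 9 \<le> (1 - p) ^ 9" using p_le elim by (intro power_mono) simp_all
      then have "1 / (1 - p) ^ 9 \<le> 1 / (1 - 1 / real n) ^ 9"
        using elim p by (intro divide_left_mono) simp_all
      ultimately show ?thesis by simp
    qed
    finally show ?case by (simp add: p_def)
  qed
  show "?e \<longlonglongrightarrow> 0" using \<alpha> by real_asymp
qed

section \<open>Counting independent sets\<close>

definition k_subsets :: "nat \<Rightarrow> nat \<Rightarrow> nat set set" where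
  "k_subsets n k = {S. S \<subseteq> {1..n} \<and> card S = k}"

definition pairs_in :: "nat set \<Rightarrow> nat set set" where
  "pairs_in S = {e. e \<subseteq> S \<and> card e = 2}"

definition indep_event :: "nat set \<Rightarrow> nat set set set" where
  "indep_event S = {E. pairs_in S \<inter> E = {}}"

lemma k_subsets_finite: "S \<in> k_subsets n k \<Longrightarrow> finite S"
  using finite_subset[of S "{1..n}"] by (simp add: k_subsets_def)

lemma finite_k_subsets: "finite (k_subsets n k)"
  by (rule finite_subset[of _ "Pow {1..n}"]) (auto simp: k_subsets_def)

lemma card_k_subsets: "card (k_subsets n k) = n choose k"
  unfolding k_subsets_def by (subst n_subsets) simp_all

lemma finite_pairs_in: "finite S \<Longrightarrow> finite (pairs_in S)"
  by (rule finite_subset[of _ "Pow S"]) (auto simp: pairs_in_def)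

lemma card_pairs_in: "finite S \<Longrightarrow> card (pairs_in S) = card S choose 2"
  unfolding pairs_in_def by (rule n_subsets)

lemma pairs_in_Int: "pairs_in S \<inter> pairs_in T = pairs_in (S \<inter> T)"
  by (auto simp: pairs_in_def)

lemma pairs_in_subset: "S \<subseteq> {1..n} \<Longrightarrow> pairs_in S \<subseteq> vertex_pairs n"
  by (auto simp: pairs_in_def vertex_pairs_def)

lemma indep_set_iff_indep_event:
  assumes "E \<subseteq> vertex_pairs n"
  shows "indep_set n E S \<longleftrightarrow> S \<subseteq> {1..n} \<and> E \<in> indep_event S"
  using assms by (auto simp: indep_set_def indep_event_def pairs_in_def vertex_pairs_def)

lemma prob_no_edges:
  assumes "0 \<le> p" "p \<le> 1" "T \<subseteq> vertex_pairs n"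
  shows "measure_pmf.prob (gnp n p) {E. T \<inter> E = {}} = (1 - p) ^ card T"
  using prob_gnp_edges[OF assms(1,2), of "{}" n T] assms(3) by simp

lemma prob_indep_event:
  assumes "0 \<le> p" "p \<le> 1" "S \<in> k_subsets n k"
  shows "measure_pmf.prob (gnp n p) (indep_event S) = (1 - p) ^ (k choose 2)"
proof -
  have "pairs_in S \<subseteq> vertex_pairs n" "card (pairs_in S) = k choose 2"
    using assms(3) k_subsets_finite[OF assms(3)]
    by (simp_all add: k_subsets_def pairs_in_subset card_pairs_in)
  then show ?thesis using prob_no_edges[OF assms(1,2)] by (simp add: indep_event_def)
qed

text \<open>The pairs inside both sets are those inside the intersection. They are required absent
  only once, which explains the correction factor.\<close>

lemma prob_indep_event_pair:
  assumes p: "0 \<le> p" "p < 1" and S: "S \<in> k_subsets n k" and T: "T \<in> k_subsets n k"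
  shows "measure_pmf.prob (gnp n p) (indep_event S \<inter> indep_event T) =
    ((1 - p) ^ (k choose 2))\<^sup>2 * (1 / (1 - p)) ^ (card (S \<inter> T) choose 2)"
proof -
  note fin = k_subsets_finite[OF S] k_subsets_finite[OF T]
  have sub: "pairs_in S \<union> pairs_in T \<subseteq> vertex_pairs n"
    using S T pairs_in_subset by (simp add: k_subsets_def)
  have "indep_event S \<inter> indep_event T = {E. (pairs_in S \<union> pairs_in T) \<inter> E = {}}"
    unfolding indep_event_def by blast
  then have prob: "measure_pmf.prob (gnp n p) (indep_event S \<inter> indep_event T) =
      (1 - p) ^ card (pairs_in S \<union> pairs_in T)"
    using prob_no_edges[OF _ _ sub, of p] p by simp
  have "card (pairs_in S) + card (pairs_in T) =
      card (pairs_in S \<union> pairs_in T) + card (pairs_in S \<inter> pairs_in T)"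
    by (rule card_Un_Int) (simp_all add: finite_pairs_in fin)
  then have "(k choose 2) + (k choose 2) = card (pairs_in S \<union> pairs_in T) + (card (S \<inter> T) choose 2)"
    using S T by (simp add: pairs_in_Int card_pairs_in fin k_subsets_def)
  then have "((1 - p) ^ (k choose 2))\<^sup>2 =
      (1 - p) ^ card (pairs_in S \<union> pairs_in T) * (1 - p) ^ (card (S \<inter> T) choose 2)"
    by (simp add: power2_eq_square flip: power_add)
  then show ?thesis using p by (simp add: prob power_one_over)
qed

lemma card_k_supersets:
  assumes J: "J \<subseteq> {1..n}" "card J = j"
  shows "card {T \<in> k_subsets n k. J \<subseteq> T} \<le> (n - j) choose (k - j)"
proof -
  have "finite J" using J(1) by (rule finite_subset) simp
  let ?U = "{U. U \<subseteq> {1..n} - J \<and> card U = k - j}"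
  have "card {T \<in> k_subsets n k. J \<subseteq> T} \<le> card ?U"
  proof (rule card_inj_on_le)
    show "inj_on (\<lambda>T. T - J) {T \<in> k_subsets n k. J \<subseteq> T}" by (rule inj_onI) blast
    show "(\<lambda>T. T - J) ` {T \<in> k_subsets n k. J \<subseteq> T} \<subseteq> ?U"
      using J \<open>finite J\<close> by (auto simp: k_subsets_def card_Diff_subset)
    show "finite ?U" by (rule finite_subset[of _ "Pow {1..n}"]) auto
  qed
  also have "\<dots> = (n - j) choose (k - j)"
    using J \<open>finite J\<close> by (subst n_subsets) (simp_all add: card_Diff_subset)
  finally show ?thesis .
qed

text \<open>The quotient of the two binomials is the product of (k - i)/(n - i) for i < j, and each
  factor is at most k/n.\<close>

lemma binomial_shift_le:
  assumes "j \<le> k" "k \<le> n"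
  shows "((n - j) choose (k - j)) * n ^ j \<le> k ^ j * (n choose k)"
  using assms(1)
proof (induction j)
  case (Suc j)
  let ?f = "\<lambda>j. (n - j) choose (k - j)"
  have "n - j = Suc (n - Suc j)" "k - j = Suc (k - Suc j)" using Suc.prems assms(2) by simp_all
  then have eq: "(k - j) * ?f j = (n - j) * ?f (Suc j)"
    using Suc_times_binomial_eq[of "n - Suc j" "k - Suc j"] by (simp add: mult.commute)
  have "k * j \<le> j * n" using assms(2) by simp
  then have le: "(k - j) * n \<le> k * (n - j)"
    unfolding diff_mult_distrib diff_mult_distrib2 by (rule diff_le_mono2)
  have "(n - j) * (?f (Suc j) * n ^ Suc j) = ((n - j) * ?f (Suc j)) * (n * n ^ j)"
    by (simp only: power_Suc mult.assoc)
  also have "\<dots> = ((k - j) * n) * (?f j * n ^ j)"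
    unfolding eq[symmetric] by (simp only: mult_ac)
  also have "\<dots> \<le> (k * (n - j)) * (k ^ j * (n choose k))"
    by (rule mult_le_mono[OF le Suc.IH]) (use Suc.prems in simp)
  also have "\<dots> = (n - j) * (k ^ Suc j * (n choose k))" by (simp only: power_Suc mult_ac)
  finally show ?case using Suc.prems assms(2) by simp
qed simp

lemma geometric_tail_le:
  fixes \<delta> :: real
  assumes "0 \<le> \<delta>" "\<delta> \<le> 1 / 2"
  shows "(\<Sum>j=2..k. \<delta> ^ j) \<le> 2 * \<delta>\<^sup>2"
proof -
  \<comment> \<open>The subtracted remainder makes the claim inductive; starting at
    \<open>Suc 0\<close> makes the first sum empty.\<close>
  have "(\<Sum>j=2..Suc k. \<delta> ^ j) \<le> 2 * \<delta>\<^sup>2 - 2 * \<delta> ^ (k + 2)" for k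
  proof (induction k)
    case (Suc k)
    have "\<delta> ^ (k + 2) * \<delta> \<le> \<delta> ^ (k + 2) * (1 / 2)" using assms by (intro mult_left_mono) simp_all
    moreover have "(\<Sum>j=2..Suc (Suc k). \<delta> ^ j) = (\<Sum>j=2..Suc k. \<delta> ^ j) + \<delta> ^ (k + 2)" by simp
    moreover have "\<delta> ^ (Suc k + 2) = \<delta> ^ (k + 2) * \<delta>" by simp
    ultimately show ?case using Suc by linarith
  qed (simp add: power2_eq_square)
  moreover have "(\<Sum>j=2..k. \<delta> ^ j) \<le> (\<Sum>j=2..Suc k. \<delta> ^ j)"
    using assms by (intro sum_mono2) auto
  moreover have "0 \<le> 2 * \<delta> ^ (k + 2)" using assms by simp
  ultimately show ?thesis by (smt (verit))
qed

text \<open>Since j(j - 1)/2 \<le> j(k - 1)/2, the weight of an overlap of size j is at most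
  geometric in j.\<close>

lemma choose_two_powr_le:
  fixes b :: real
  assumes "b \<ge> 1" "j \<le> k"
  shows "b ^ (j choose 2) \<le> (b powr ((real k - 1) / 2)) ^ j"
proof (cases "j = 0")
  case False
  have "real (j choose 2) = real j * (real j - 1) / 2" by (rule real_choose_two)
  also have "\<dots> \<le> real j * ((real k - 1) / 2)"
    using assms(2) by (simp add: mult_left_mono)
  finally have "b powr real (j choose 2) \<le> b powr (real j * ((real k - 1) / 2))"
    using assms(1) by (rule powr_mono)
  then show ?thesis
    using assms(1) by (simp add: powr_realpow powr_power mult.commute)
qed (simp add: choose_two)

text \<open>The cost of one common vertex of two k-sets: at most k choices inside the first set, a
  factor k/n for the second set to contain it, and q^(-(k-1)/2) for its share of the common
  pairs.\<close>

definition overlap_bound :: "nat \<Rightarrow> nat \<Rightarrow> real \<Rightarrow> real" where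
  "overlap_bound n k q = (real k)\<^sup>2 / real n * (1 / q) powr ((real k - 1) / 2)"

text \<open>Overlaps of size 0 or 1 have weight 1 and give the main term. Those of size j \<ge> 2
  contribute at most a fraction \<delta>^j each, a geometric series of sum at most 2
  \<delta>^2.\<close>

lemma sum_overlap_le:
  assumes S: "S \<in> k_subsets n k" and q: "0 < q" "q \<le> 1" and kn: "k \<le> n" "0 < n"
    and \<delta>: "\<delta> = overlap_bound n k q" "\<delta> \<le> 1 / 2"
  shows "(\<Sum>T\<in>k_subsets n k. (1 / q) ^ (card (S \<inter> T) choose 2)) \<le> (1 + 2 * \<delta>\<^sup>2) * real (n choose k)"
proof -
  define N where "N = real (n choose k)"
  define w :: "nat \<Rightarrow> real" where "w j = (1 / q) ^ (j choose 2)" for j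
  have w1: "1 \<le> w j" for j unfolding w_def using q by (intro one_le_power) simp
  have w0: "w j \<ge> 0" for j using w1[of j] by linarith
  note fin = k_subsets_finite[OF S]
  have Sn: "S \<subseteq> {1..n}" "card S = k" using S by (simp_all add: k_subsets_def)
  define \<J> where "\<J> = {J. J \<subseteq> S \<and> 2 \<le> card J}"
  have finJ: "finite \<J>" by (rule finite_subset[of _ "Pow S"]) (auto simp: \<J>_def fin)
  have \<delta>0: "\<delta> \<ge> 0" by (simp add: \<delta>(1) overlap_bound_def)
  \<comment> \<open>The term for J equal to the overlap already suffices. Summing over all its
    subsets overcounts, but allows the sums over T and J to be exchanged.\<close>
  have split: "w (card (S \<inter> T)) \<le> 1 + (\<Sum>J\<in>\<J>. if J \<subseteq> T then w (card J) else 0)" for T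
  proof (cases "2 \<le> card (S \<inter> T)")
    case True
    have "w (card (S \<inter> T)) = (\<Sum>J\<in>{S \<inter> T}. if J \<subseteq> T then w (card J) else 0)" by simp
    also have "\<dots> \<le> (\<Sum>J\<in>\<J>. if J \<subseteq> T then w (card J) else 0)"
      by (rule sum_mono2) (use True finJ w0 in \<open>auto simp: \<J>_def\<close>)
    finally show ?thesis by simp
  next
    case False
    then have "w (card (S \<inter> T)) = 1" by (simp add: w_def binomial_eq_0)
    moreover have "0 \<le> (\<Sum>J\<in>\<J>. if J \<subseteq> T then w (card J) else 0)"
      by (rule sum_nonneg) (simp add: w0)
    ultimately show ?thesis by simp
  qed
  have summand: "real (k choose j) * (w j * real ((n - j) choose (k - j))) \<le> \<delta> ^ j * N"
    if "j \<in> {2..k}" for j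
  proof -
    have j: "j \<le> k" using that by simp
    define s where "s = (1 / q) powr ((real k - 1) / 2)"
    have "w j \<le> s ^ j" unfolding w_def s_def by (rule choose_two_powr_le[OF _ j]) (use q in simp)
    moreover have "real (k choose j) \<le> real k ^ j"
      using binomial_le_pow[OF j] by (metis of_nat_le_iff of_nat_power)
    moreover have "real ((n - j) choose (k - j)) \<le> (real k / real n) ^ j * N"
    proof -
      have "real (((n - j) choose (k - j)) * n ^ j) \<le> real (k ^ j * (n choose k))"
        using binomial_shift_le[OF j kn(1)] by (simp only: of_nat_le_iff)
      then show ?thesis using kn(2) by (simp add: N_def power_divide field_simps)
    qed
    ultimately have "real (k choose j) * (w j * real ((n - j) choose (k - j))) \<le>
        real k ^ j * (s ^ j * ((real k / real n) ^ j * N))"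
      by (intro mult_mono mult_nonneg_nonneg) (simp_all add: w0 s_def)
    also have "\<dots> = \<delta> ^ j * N"
      by (simp add: \<delta>(1) overlap_bound_def s_def power2_eq_square power_mult_distrib power_divide)
    finally show ?thesis .
  qed
  have "(\<Sum>T\<in>k_subsets n k. w (card (S \<inter> T))) \<le>
      (\<Sum>T\<in>k_subsets n k. 1 + (\<Sum>J\<in>\<J>. if J \<subseteq> T then w (card J) else 0))"
    by (rule sum_mono) (rule split)
  also have "\<dots> = N + (\<Sum>J\<in>\<J>. \<Sum>T\<in>k_subsets n k. if J \<subseteq> T then w (card J) else 0)"
    unfolding sum.distrib by (subst sum.swap) (simp add: card_k_subsets N_def)
  also have "\<dots> = N + (\<Sum>J\<in>\<J>. w (card J) * real (card {T \<in> k_subsets n k. J \<subseteq> T}))"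
    by (simp add: sum.If_cases[OF finite_k_subsets] Int_def mult.commute)
  also have "\<dots> \<le> N + (\<Sum>J\<in>\<J>. w (card J) * real ((n - card J) choose (k - card J)))"
  proof (intro add_left_mono sum_mono mult_left_mono w0)
    fix J assume "J \<in> \<J>"
    then have "J \<subseteq> {1..n}" using Sn by (auto simp: \<J>_def)
    then show "real (card {T \<in> k_subsets n k. J \<subseteq> T}) \<le> real ((n - card J) choose (k - card J))"
      using card_k_supersets[of J n "card J" k] by (simp only: of_nat_le_iff)
  qed
  also have "(\<Sum>J\<in>\<J>. w (card J) * real ((n - card J) choose (k - card J))) =
      (\<Sum>j\<in>{2..k}. \<Sum>J\<in>{J \<in> \<J>. card J = j}. w (card J) * real ((n - card J) choose (k - card J)))"
    by (rule sum.group[symmetric]) (use finJ card_mono[OF fin] Sn in \<open>auto simp: \<J>_def\<close>)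
  also have "\<dots> = (\<Sum>j\<in>{2..k}. real (k choose j) * (w j * real ((n - j) choose (k - j))))"
  proof (rule sum.cong)
    fix j assume "j \<in> {2..k}"
    then have "{J \<in> \<J>. card J = j} = {J. J \<subseteq> S \<and> card J = j}" by (auto simp: \<J>_def)
    then have "card {J \<in> \<J>. card J = j} = k choose j" using n_subsets[OF fin] Sn by simp
    then show "(\<Sum>J\<in>{J \<in> \<J>. card J = j}. w (card J) * real ((n - card J) choose (k - card J))) =
        real (k choose j) * (w j * real ((n - j) choose (k - j)))" by simp
  qed simp
  also have "\<dots> \<le> (\<Sum>j\<in>{2..k}. \<delta> ^ j * N)" by (rule sum_mono) (rule summand)
  also have "\<dots> \<le> (2 * \<delta>\<^sup>2) * N"
    unfolding sum_distrib_right[symmetric]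
    by (intro mult_right_mono geometric_tail_le \<delta>0 \<delta>(2)) (simp add: N_def)
  finally show ?thesis by (simp add: w_def N_def algebra_simps)
qed

section \<open>Numbers of independent sets of two consecutive sizes\<close>

definition indep_count :: "nat \<Rightarrow> nat \<Rightarrow> nat set set \<Rightarrow> real" where
  "indep_count n k E = real (card {S \<in> k_subsets n k. E \<in> indep_event S})"

definition indep_mean :: "nat \<Rightarrow> nat \<Rightarrow> real \<Rightarrow> real" where
  "indep_mean n k q = real (n choose k) * q ^ (k choose 2)"

lemma expectation_indep_count:
  assumes "0 \<le> p" "p \<le> 1"
  shows "measure_pmf.expectation (gnp n p) (indep_count n k) = indep_mean n k (1 - p)"
  unfolding indep_count_def
  by (subst expectation_card[OF finite_k_subsets finite_set_pmf_gnp])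
    (simp add: prob_indep_event[OF assms] indep_mean_def card_k_subsets)

lemma indep_count_concentrated:
  assumes p: "0 \<le> p" "p < 1" and kn: "k \<le> n" "0 < n"
    and \<delta>: "\<delta> = overlap_bound n k (1 - p)" "\<delta> \<le> 1 / 2"
  shows "measure_pmf.prob (gnp n p) {E. indep_count n k E \<le> indep_mean n k (1 - p) / 2} \<le> 8 * \<delta>\<^sup>2"
proof -
  let ?M = "gnp n p" and ?I = "k_subsets n k"
  define a where "a = (1 - p) ^ (k choose 2)"
  have \<mu>: "indep_mean n k (1 - p) = (\<Sum>S\<in>?I. measure_pmf.prob ?M (indep_event S))"
    using p by (simp add: prob_indep_event indep_mean_def card_k_subsets)
  have pos: "indep_mean n k (1 - p) > 0" using p kn by (simp add: indep_mean_def)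
  have "(\<Sum>S\<in>?I. \<Sum>T\<in>?I. measure_pmf.prob ?M (indep_event S \<inter> indep_event T)) =
      (\<Sum>S\<in>?I. a\<^sup>2 * (\<Sum>T\<in>?I. (1 / (1 - p)) ^ (card (S \<inter> T) choose 2)))"
    by (simp add: prob_indep_event_pair[OF p] a_def sum_distrib_left cong: sum.cong)
  also have "\<dots> \<le> (\<Sum>S\<in>?I. a\<^sup>2 * ((1 + 2 * \<delta>\<^sup>2) * real (n choose k)))"
    by (intro sum_mono mult_left_mono sum_overlap_le) (use p kn \<delta> in simp_all)
  also have "\<dots> = (1 + 2 * \<delta>\<^sup>2) * (indep_mean n k (1 - p))\<^sup>2"
    by (simp add: card_k_subsets indep_mean_def a_def power2_eq_square algebra_simps)
  finally have "measure_pmf.prob ?M {E. real (card {S \<in> ?I. E \<in> indep_event S}) \<le> indep_mean n k (1 - p) / 2}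
      \<le> 4 * (2 * \<delta>\<^sup>2)"
    by (rule second_moment[OF finite_k_subsets finite_set_pmf_gnp \<mu> pos])
  then show ?thesis by (simp add: indep_count_def)
qed

text \<open>Each independent k-set then arises by deleting a vertex from an independent (k + 1)-set,
  which has k + 1 vertices to delete. Used in contrapositive form to produce a maximal set of size
  k.\<close>

lemma indep_count_le_extensions:
  assumes E: "E \<subseteq> vertex_pairs n" and no: "\<And>S. max_indep_set n E S \<Longrightarrow> card S \<noteq> k"
  shows "indep_count n k E \<le> real (k + 1) * indep_count n (k + 1) E"
proof -
  let ?X = "{S \<in> k_subsets n k. E \<in> indep_event S}"
  let ?Y = "{S \<in> k_subsets n (k + 1). E \<in> indep_event S}"
  have finY: "finite ?Y" using finite_k_subsets[of n "k + 1"] by simp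
  have "?X \<subseteq> (\<Union>T\<in>?Y. (\<lambda>v. T - {v}) ` T)"
  proof
    fix S assume "S \<in> ?X"
    then have S: "indep_set n E S" "card S = k"
      using indep_set_iff_indep_event[OF E] by (auto simp: k_subsets_def)
    then have "\<not> max_indep_set n E S" using no by blast
    then obtain U where U: "indep_set n E U" "S \<subseteq> U" "U \<noteq> S"
      using S(1) unfolding max_indep_set_def by blast
    then obtain v where v: "v \<in> U" "v \<notin> S" by blast
    have "finite S" using S(1) finite_subset by (auto simp: indep_set_def)
    have "indep_set n E (insert v S)"
      using U(1,2) v(1) unfolding indep_set_def by (meson insert_subset subset_trans)
    then have "insert v S \<in> ?Y"
      using indep_set_iff_indep_event[OF E] S(2) v(2) \<open>finite S\<close> by (auto simp: k_subsets_def)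
    moreover have "S \<in> (\<lambda>u. insert v S - {u}) ` insert v S"
      using v(2) by (intro image_eqI[of _ _ v]) auto
    ultimately show "S \<in> (\<Union>T\<in>?Y. (\<lambda>v. T - {v}) ` T)" by (rule UN_I)
  qed
  moreover have fin: "finite (\<Union>T\<in>?Y. (\<lambda>v. T - {v}) ` T)"
    using finY k_subsets_finite by blast
  ultimately have "card ?X \<le> card (\<Union>T\<in>?Y. (\<lambda>v. T - {v}) ` T)" by (intro card_mono)
  also have "\<dots> \<le> (\<Sum>T\<in>?Y. card ((\<lambda>v. T - {v}) ` T))" by (rule card_UN_le[OF finY])
  also have "\<dots> \<le> (\<Sum>T\<in>?Y. k + 1)"
  proof (rule sum_mono)
    fix T assume "T \<in> ?Y"
    then have T: "T \<in> k_subsets n (k + 1)" by simp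
    then have "card T = k + 1" by (simp add: k_subsets_def)
    then show "card ((\<lambda>v. T - {v}) ` T) \<le> k + 1"
      using card_image_le[OF k_subsets_finite[OF T], of "\<lambda>v. T - {v}"] by simp
  qed
  also have "\<dots> = (k + 1) * card ?Y" by simp
  finally have "real (card ?X) \<le> real ((k + 1) * card ?Y)" by (simp only: of_nat_le_iff)
  then show ?thesis unfolding indep_count_def of_nat_mult .
qed

text \<open>Both sides are the expected number of independent (k + 1)-sets with one marked vertex;
  on the right the other k vertices are chosen first.\<close>

lemma indep_mean_Suc:
  "real (k + 1) * indep_mean n (k + 1) q = real (n - k) * q ^ k * indep_mean n k q"
proof (cases "k < n")
  case True
  then have "(k + 1) * (n choose (k + 1)) = (n - k) * (n choose k)"
    using binomial_absorb_comp[of n k] binomial_absorption[of k n] by (simp add: algebra_simps)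
  then have "real (k + 1) * real (n choose (k + 1)) = real (n - k) * real (n choose k)"
    by (metis of_nat_mult)
  moreover have "(k + 1) choose 2 = k + (k choose 2)"
    by (simp add: numeral_2_eq_2)
  moreover have "real (k + 1) * (real (n choose (k + 1)) * q ^ (k + (k choose 2))) =
      (real (k + 1) * real (n choose (k + 1))) * (q ^ k * q ^ (k choose 2))"
    by (simp only: power_add mult.assoc)
  ultimately show ?thesis
    unfolding indep_mean_def by (simp only: mult_ac)
qed (simp add: indep_mean_def binomial_eq_0)

lemma overlap_bound_mono:
  assumes "0 < q" "q \<le> 1"
  shows "overlap_bound n k q \<le> overlap_bound n (k + 1) q"
proof -
  have "1 / q \<ge> 1" using assms by simp
  then have "(1 / q) powr ((real k - 1) / 2) \<le> (1 / q) powr ((real (k + 1) - 1) / 2)"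
    by (intro powr_mono) simp_all
  moreover have "(real k)\<^sup>2 / real n \<le> (real (k + 1))\<^sup>2 / real n"
    by (intro divide_right_mono power_mono) simp_all
  ultimately show ?thesis unfolding overlap_bound_def by (intro mult_mono) simp_all
qed

text \<open>Outside the bad events there are more independent k-sets than (k + 1)-sets can cover,
  hence a maximal one of size k; and there is an independent set of size k + 1.\<close>

lemma whp_not_unmixed_dense:
  fixes p :: "nat \<Rightarrow> real" and k :: "nat \<Rightarrow> nat"
  assumes p: "eventually (\<lambda>n. 0 \<le> p n \<and> p n < 1) sequentially"
    and lim1: "(\<lambda>n. real n * (1 - p n) ^ k n) \<longlonglongrightarrow> 0"
    and lim2: "(\<lambda>n. overlap_bound n (k n + 1) (1 - p n)) \<longlonglongrightarrow> 0"
  shows "gnp_whp p (\<lambda>n E. \<not> unmixed (mpoly_ring n) (edge_ideal n E :: 'k::field mpoly set))"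
proof (rule gnp_whp_by_bound)
  let ?\<mu> = "\<lambda>n j. indep_mean n j (1 - p n)"
  let ?\<delta> = "\<lambda>n. overlap_bound n (k n + 1) (1 - p n)"
  let ?B1 = "\<lambda>n. {E. indep_count n (k n) E \<le> ?\<mu> n (k n) / 2}"
  let ?B2 = "\<lambda>n. {E. indep_count n (k n + 1) E \<le> ?\<mu> n (k n + 1) / 2}"
  let ?B3 = "\<lambda>n. {E. real (k n + 1) * indep_count n (k n + 1) E \<ge> ?\<mu> n (k n) / 2}"
  let ?B = "\<lambda>n. ?B1 n \<union> ?B2 n \<union> ?B3 n"
  have \<delta>_le: "eventually (\<lambda>n. ?\<delta> n < 1 / 2) sequentially"
    using order_tendstoD(2)[OF lim2, of "1/2"] by simp
  \<comment> \<open>No separate growth condition on \<open>k\<close> is imposed: if k + 1 exceeded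
    n, both factors of the overlap bound would be at least 1.\<close>
  have k_le: "k n + 1 \<le> n" if "n \<ge> 1" "0 \<le> p n" "p n < 1" "?\<delta> n < 1 / 2" for n
  proof (rule ccontr)
    assume "\<not> k n + 1 \<le> n"
    then have n: "real n \<le> real (k n + 1)" by simp
    have "1 / (1 - p n) \<ge> 1" using that by simp
    then have "1 \<le> (1 / (1 - p n)) powr ((real (k n + 1) - 1) / 2)"
      by (intro ge_one_powr_ge_zero) simp_all
    moreover have "1 \<le> (real (k n + 1))\<^sup>2 / real n"
    proof -
      have "real n \<le> real (k n + 1) * real (k n + 1)"
        using n mult_mono[of 1 "real (k n + 1)" "real n" "real (k n + 1)"] by simp
      then show ?thesis using that(1) by (simp add: power2_eq_square)
    qed
    ultimately have "1 * 1 \<le> ?\<delta> n" unfolding overlap_bound_def by (intro mult_mono) simp_all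
    then show False using that(4) by simp
  qed
  show "eventually (\<lambda>n. \<forall>E \<subseteq> vertex_pairs n. E \<notin> ?B n \<longrightarrow>
      \<not> unmixed (mpoly_ring n) (edge_ideal n E :: 'k mpoly set)) sequentially"
    using p
  proof eventually_elim
    case (elim n)
    show ?case
    proof (intro allI impI)
      fix E assume E: "E \<subseteq> vertex_pairs n" "E \<notin> ?B n"
      obtain S where S: "max_indep_set n E S" "card S = k n"
      proof (rule ccontr)
        assume "\<not> thesis"
        then have "indep_count n (k n) E \<le> real (k n + 1) * indep_count n (k n + 1) E"
          using that by (intro indep_count_le_extensions[OF E(1)]) blast
        then show False using E(2) by simp
      qed
      have "?\<mu> n (k n + 1) \<ge> 0" using elim by (simp add: indep_mean_def)
      then have "indep_count n (k n + 1) E > 0" using E(2) by simp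
      then obtain T where "T \<in> k_subsets n (k n + 1)" "E \<in> indep_event T"
        by (auto simp: indep_count_def card_gt_0_iff)
      then have T: "indep_set n E T" "card T = k n + 1"
        using indep_set_iff_indep_event[OF E(1)] by (auto simp: k_subsets_def)
      show "\<not> unmixed (mpoly_ring n) (edge_ideal n E :: 'k mpoly set)"
        by (rule not_unmixed_if[OF E(1) S(1) T(1)]) (simp add: S(2) T(2))
    qed
  qed
  show "eventually (\<lambda>n. measure_pmf.prob (gnp n (p n)) (?B n) \<le>
      16 * (?\<delta> n)\<^sup>2 + 2 * (real n * (1 - p n) ^ k n)) sequentially"
    using p \<delta>_le eventually_ge_at_top[of 1]
  proof eventually_elim
    case (elim n)
    let ?M = "gnp n (p n)"
    have kn: "k n + 1 \<le> n" by (rule k_le) (use elim in auto)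
    have q: "0 < 1 - p n" "1 - p n \<le> 1" using elim by auto
    have mono: "overlap_bound n (k n) (1 - p n) \<le> ?\<delta> n" by (rule overlap_bound_mono[OF q])
    have nonneg: "0 \<le> overlap_bound n (k n) (1 - p n)" by (simp add: overlap_bound_def)
    have "measure_pmf.prob ?M (?B1 n) \<le> 8 * (overlap_bound n (k n) (1 - p n))\<^sup>2"
      by (rule indep_count_concentrated) (use elim kn mono in auto)
    also have "\<dots> \<le> 8 * (?\<delta> n)\<^sup>2" using power_mono[OF mono nonneg, of 2] by simp
    finally have B1: "measure_pmf.prob ?M (?B1 n) \<le> 8 * (?\<delta> n)\<^sup>2" .
    have B2: "measure_pmf.prob ?M (?B2 n) \<le> 8 * (?\<delta> n)\<^sup>2"
      by (rule indep_count_concentrated) (use elim kn in auto)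
    have pos: "?\<mu> n (k n) > 0" using q kn by (simp add: indep_mean_def)
    \<comment> \<open>Markov's inequality at half the mean number of k-sets; by
      \<open>indep_mean_Suc\<close> the quotient is 2 (n - k) q^k.\<close>
    have "measure_pmf.prob ?M (?B3 n) \<le>
        measure_pmf.expectation ?M (\<lambda>E. real (k n + 1) * indep_count n (k n + 1) E) / (?\<mu> n (k n) / 2)"
      by (rule markov_pmf[OF finite_set_pmf_gnp]) (use pos in \<open>simp_all add: indep_count_def\<close>)
    also have "measure_pmf.expectation ?M (\<lambda>E. real (k n + 1) * indep_count n (k n + 1) E) =
        real (k n + 1) * indep_mean n (k n + 1) (1 - p n)"
      using elim expectation_indep_count[of "p n" n "k n + 1"] by simp
    also have "\<dots> / (?\<mu> n (k n) / 2) = 2 * (real (n - k n) * (1 - p n) ^ k n)"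
      unfolding indep_mean_Suc using pos by simp
    also have "\<dots> \<le> 2 * (real n * (1 - p n) ^ k n)"
      using q by (intro mult_left_mono mult_right_mono) simp_all
    finally have B3: "measure_pmf.prob ?M (?B3 n) \<le> 2 * (real n * (1 - p n) ^ k n)" .
    have "measure_pmf.prob ?M (?B n) \<le>
        measure_pmf.prob ?M (?B1 n) + measure_pmf.prob ?M (?B2 n) + measure_pmf.prob ?M (?B3 n)"
      using measure_Un_le[of "?B1 n" ?M "?B2 n"] measure_Un_le[of "?B1 n \<union> ?B2 n" ?M "?B3 n"]
      by simp
    then show ?case using B1 B2 B3 by linarith
  qed
  show "(\<lambda>n. 16 * (?\<delta> n)\<^sup>2 + 2 * (real n * (1 - p n) ^ k n)) \<longlonglongrightarrow> 0"
    using tendsto_add[OF tendsto_mult_left[OF tendsto_power[OF lim2, of 2], of 16]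
        tendsto_mult_left[OF lim1, of 2]] by simp
qed

section \<open>Dense random graphs\<close>

lemma whp_not_unmixed_constant:
  assumes p: "0 < p" "p < 1"
  shows "gnp_whp (\<lambda>n. p) (\<lambda>n E. \<not> unmixed (mpoly_ring n) (edge_ideal n E :: 'k::field mpoly set))"
proof -
  define b where "b = 1 / (1 - p)"
  have b: "b > 1" and q: "1 - p = 1 / b" using p by (simp_all add: b_def)
  have lnb: "ln b > 0" using b by simp
  \<comment> \<open>The factor 3/2 is the middle of the window from 1 to 2: n q^k is at most
    n^(-1/2), and the overlap bound is of order (log n)^2 n^(-1/4).\<close>
  define k where "k n = nat \<lceil>3 / 2 * log b (real n)\<rceil>" for n
  have k_ge: "3 / 2 * log b (real n) \<le> real (k n)" for n
    unfolding k_def by (rule real_nat_ceiling_ge)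
  have k_le: "real (k n) \<le> 3 / 2 * log b (real n) + 1" if "n \<ge> 1" for n
  proof -
    have "0 \<le> log b (real n)" using b that by simp
    then have "real (k n) = of_int \<lceil>3 / 2 * log b (real n)\<rceil>" by (simp add: k_def)
    then show ?thesis by linarith
  qed
  show ?thesis
  proof (rule whp_not_unmixed_dense)
    show "eventually (\<lambda>n. 0 \<le> p \<and> p < 1) sequentially" using p by simp
    show "(\<lambda>n. real n * (1 - p) ^ k n) \<longlonglongrightarrow> 0"
    proof (rule tendsto_sandwich)
      show "eventually (\<lambda>n. real n * (1 - p) ^ k n \<le> real n * real n powr (- (3 / 2))) sequentially"
        using eventually_ge_at_top[of 1]
      proof eventually_elim
        case (elim n)
        have "(1 - p) ^ k n = b powr (- real (k n))"
          using b by (simp add: q powr_minus_divide powr_realpow power_one_over)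
        also have "\<dots> \<le> b powr (- (3 / 2) * log b (real n))"
          using k_ge[of n] b by (intro powr_mono) simp_all
        also have "\<dots> = real n powr (- (3 / 2))"
          using b elim by (simp add: powr_def log_def)
        finally show ?case by (intro mult_left_mono) simp_all
      qed
      show "eventually (\<lambda>n. 0 \<le> real n * (1 - p) ^ k n) sequentially" using p by simp
      show "(\<lambda>n. real n * real n powr (- (3 / 2))) \<longlonglongrightarrow> 0" by real_asymp
    qed simp
    \<comment> \<open>The 2 comes from rounding up and from using k + 1; the factor
      \<open>b powr (1 / 2)\<close> is the effect of rounding on the power.\<close>
    let ?f = "\<lambda>n. (3 / 2 * (ln (real n) / ln b) + 2)\<^sup>2 / real n * (b powr (1 / 2) * real n powr (3 / 4))"
    show "(\<lambda>n. overlap_bound n (k n + 1) (1 - p)) \<longlonglongrightarrow> 0"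
    proof (rule tendsto_sandwich)
      show "eventually (\<lambda>n. 0 \<le> overlap_bound n (k n + 1) (1 - p)) sequentially"
        by (simp add: overlap_bound_def)
      show "eventually (\<lambda>n. overlap_bound n (k n + 1) (1 - p) \<le> ?f n) sequentially"
        using eventually_ge_at_top[of 1]
      proof eventually_elim
        case (elim n)
        have "b powr ((real (k n + 1) - 1) / 2) \<le> b powr (1 / 2 + 3 / 4 * log b (real n))"
          using k_le[OF elim] b by (intro powr_mono) simp_all
        also have "\<dots> = b powr (1 / 2) * real n powr (3 / 4)"
          using b elim unfolding powr_add by (simp add: powr_def log_def)
        finally have "b powr ((real (k n + 1) - 1) / 2) \<le> b powr (1 / 2) * real n powr (3 / 4)" .
        moreover have "(real (k n + 1))\<^sup>2 / real n \<le> (3 / 2 * (ln (real n) / ln b) + 2)\<^sup>2 / real n"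
          using k_le[OF elim] by (intro divide_right_mono power_mono) (simp_all add: log_def)
        ultimately show ?case
          unfolding overlap_bound_def q by (intro mult_mono) simp_all
      qed
      show "?f \<longlonglongrightarrow> 0" using lnb b by real_asymp
    qed simp
  qed
qed

text \<open>With constant k the two quantities are n^(1 - k\<alpha>) and (k + 1)^2 n^(k\<alpha>/2 -
  1), which explains the bounds 1 and 2.\<close>

lemma whp_not_unmixed_polynomial:
  assumes k: "1 < real k * \<alpha>" "real k * \<alpha> < 2"
  shows "gnp_whp (\<lambda>n. 1 - real n powr (-\<alpha>))
    (\<lambda>n E. \<not> unmixed (mpoly_ring n) (edge_ideal n E :: 'k::field mpoly set))"
proof (rule whp_not_unmixed_dense)
  have "0 < real k * \<alpha>" using k by linarith
  then have \<alpha>: "0 \<le> \<alpha>" by (simp add: zero_less_mult_iff)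
  show "eventually (\<lambda>n. 0 \<le> 1 - real n powr (-\<alpha>) \<and> 1 - real n powr (-\<alpha>) < 1) sequentially"
    using eventually_ge_at_top[of 1]
  proof eventually_elim
    case (elim n)
    then show ?case using powr_minus_le_one[OF elim \<alpha>] by simp
  qed
  define c where "c = real k * \<alpha>"
  have "eventually (\<lambda>n. real n * real n powr (- c) = real n * (1 - (1 - real n powr (-\<alpha>))) ^ k) sequentially"
    using eventually_ge_at_top[of 1]
    by eventually_elim (simp add: c_def powr_power mult.commute)
  moreover have "(\<lambda>n. real n * real n powr (- c)) \<longlonglongrightarrow> 0" using k(1) unfolding c_def[symmetric] by real_asymp
  ultimately show "(\<lambda>n. real n * (1 - (1 - real n powr (-\<alpha>))) ^ k) \<longlonglongrightarrow> 0"
    by (rule Lim_transform_eventually[rotated])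
  have "eventually (\<lambda>n. (real k + 1)\<^sup>2 / real n * real n powr (c / 2) =
      overlap_bound n (k + 1) (1 - (1 - real n powr (-\<alpha>)))) sequentially"
    using eventually_ge_at_top[of 1]
  proof eventually_elim
    case (elim n)
    then have "1 / real n powr (-\<alpha>) = real n powr \<alpha>" by (simp add: powr_minus_divide)
    then show ?case by (simp add: overlap_bound_def powr_powr c_def mult_ac add_ac)
  qed
  moreover have "(\<lambda>n. (real k + 1)\<^sup>2 / real n * real n powr (c / 2)) \<longlonglongrightarrow> 0"
    using k(2) unfolding c_def[symmetric] by real_asymp
  ultimately show "(\<lambda>n. overlap_bound n (k + 1) (1 - (1 - real n powr (-\<alpha>)))) \<longlonglongrightarrow> 0"
    by (rule Lim_transform_eventually[rotated])
qed

text \<open>For \<open>\<alpha> = 1\<close> there is no suitable constant \<open>k\<close>. Instead, with high probability some vertex is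
  adjacent to all others, while the graph is not complete.\<close>

definition star :: "nat \<Rightarrow> nat \<Rightarrow> nat set set" where
  "star n v = {e \<in> vertex_pairs n. v \<in> e}"

lemma prob_edges:
  assumes "0 \<le> p" "p \<le> 1" "S \<subseteq> vertex_pairs n"
  shows "measure_pmf.prob (gnp n p) {E. S \<subseteq> E} = p ^ card S"
  using prob_gnp_edges[OF assms(1-3), of "{}"] by simp

text \<open>The universal vertex alone is a maximal independent set of size 1, while a missing pair
  is an independent set of size 2.\<close>

lemma not_unmixed_universal_vertex:
  assumes E: "E \<subseteq> vertex_pairs n" and v: "v \<in> {1..n}" "star n v \<subseteq> E"
    and e: "e \<in> vertex_pairs n" "e \<notin> E"
  shows "\<not> unmixed (mpoly_ring n) (edge_ideal n E :: 'k::field mpoly set)"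
proof (rule not_unmixed_if[OF E])
  have card2: "f \<in> E \<Longrightarrow> card f = 2" for f using E by (auto simp: vertex_pairs_def)
  show "max_indep_set n E {v}"
    unfolding max_indep_set_def
  proof (intro conjI allI impI)
    show "indep_set n E {v}"
      using v(1) card2 by (force simp: indep_set_def dest!: subset_singletonD)
    fix T assume T: "indep_set n E T \<and> {v} \<subseteq> T"
    have "u = v" if "u \<in> T" for u
    proof (rule ccontr)
      assume "u \<noteq> v"
      moreover have "u \<in> {1..n}" using T that by (auto simp: indep_set_def)
      ultimately have "{u, v} \<in> star n v"
        using v(1) by (simp add: star_def doubleton_mem_vertex_pairs)
      then have "{u, v} \<in> E" using v(2) by blast
      moreover have "{u, v} \<subseteq> T" using T that by simp
      ultimately show False using T by (auto simp: indep_set_def)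
    qed
    then show "T = {v}" using T by blast
  qed
  show "indep_set n E e"
    unfolding indep_set_def
  proof (intro conjI ballI notI)
    show "e \<subseteq> {1..n}" using e(1) by (simp add: vertex_pairs_def)
    fix f assume f: "f \<in> E" "f \<subseteq> e"
    have "finite e" "card e = 2" using e(1) by (simp_all add: vertex_pairs_def card_ge_0_finite)
    then have "f = e" using card_subset_eq[of e f] f card2 by simp
    then show False using f(1) e(2) by simp
  qed
  show "card {v} < card e" using e(1) by (simp add: vertex_pairs_def)
qed

text \<open>A vertex is universal with probability at least (1 - 1/n)^n, which tends to 1/e, so the
  mean grows linearly. Two stars share at most one pair, so the second moment applies with
  correlation factor 1/p.\<close>

lemma whp_not_unmixed_one:
  "gnp_whp (\<lambda>n. 1 - real n powr (-1))
    (\<lambda>n E. \<not> unmixed (mpoly_ring n) (edge_ideal n E :: 'k::field mpoly set))"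
proof (rule gnp_whp_by_bound)
  let ?p = "\<lambda>n. 1 - 1 / real n"
  let ?B1 = "\<lambda>n. {E. \<forall>v\<in>{1..n}. E \<notin> {E. star n v \<subseteq> E}}"
  let ?B2 = "\<lambda>n. {E. vertex_pairs n \<subseteq> E}"
  let ?B = "\<lambda>n. ?B1 n \<union> ?B2 n"
  show "eventually (\<lambda>n. \<forall>E \<subseteq> vertex_pairs n. E \<notin> ?B n \<longrightarrow>
      \<not> unmixed (mpoly_ring n) (edge_ideal n E :: 'k mpoly set)) sequentially"
  proof (intro always_eventually allI impI)
    fix n E assume E: "E \<subseteq> vertex_pairs n" "E \<notin> ?B n"
    then obtain v e where "v \<in> {1..n}" "star n v \<subseteq> E" "e \<in> vertex_pairs n" "e \<notin> E" by blast
    then show "\<not> unmixed (mpoly_ring n) (edge_ideal n E :: 'k mpoly set)"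
      by (rule not_unmixed_universal_vertex[OF E(1)])
  qed
  let ?e = "\<lambda>n. 4 * (1 / (real n * ?p n ^ n) + (1 / ?p n - 1)) + ?p n powr (real n * (real n - 1) / 2)"
  show "eventually (\<lambda>n. measure_pmf.prob (gnp n (1 - real n powr (-1))) (?B n) \<le> ?e n) sequentially"
    using eventually_ge_at_top[of 2]
  proof eventually_elim
    case (elim n)
    define p where "p = ?p n"
    have p: "0 < p" "p < 1" "0 \<le> p" "p \<le> 1" using elim by (simp_all add: p_def)
    have p_eq: "1 - real n powr (-1) = p" using elim by (simp add: p_def powr_minus_divide)
    let ?M = "gnp n p"
    have star: "star n v \<subseteq> vertex_pairs n" for v :: nat by (auto simp: star_def)
    have fin: "finite (star n v)" for v :: nat by (rule finite_subset[OF star finite_vertex_pairs])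
    have card_star: "card (star n v) \<le> n" for v :: nat
      using card_pairs_meeting[of "{v}" n] by (simp add: star_def)
    define \<mu> where "\<mu> = (\<Sum>v\<in>{1..n}. measure_pmf.prob ?M {E. star n v \<subseteq> E})"
    have "real n * p ^ n = (\<Sum>v\<in>{1..n}. p ^ n)" by simp
    also have "\<dots> \<le> \<mu>"
      unfolding \<mu>_def
    proof (rule sum_mono)
      fix v :: nat
      show "p ^ n \<le> measure_pmf.prob ?M {E. star n v \<subseteq> E}"
        unfolding prob_edges[OF p(3,4) star] using p card_star by (intro power_decreasing) simp_all
    qed
    finally have \<mu>_ge: "real n * p ^ n \<le> \<mu>" .
    have pos: "0 < real n * p ^ n" using p elim by simp
    have "measure_pmf.prob ?M (?B1 n) \<le> 4 * (1 / \<mu> + (1 / p - 1))"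
    proof (rule second_moment_almost_independent[OF _ finite_set_pmf_gnp \<mu>_def])
      show "\<mu> > 0" using \<mu>_ge pos by linarith
      show "0 \<le> 1 / p - 1" using p by simp
    next
      fix v w :: nat assume "v \<noteq> w"
      have "star n v \<inter> star n w \<subseteq> {{v, w}}"
      proof
        fix e assume e: "e \<in> star n v \<inter> star n w"
        then have "e \<in> vertex_pairs n" "v \<in> e" by (simp_all add: star_def)
        then obtain u where "e = {v, u}" by (rule vertex_pairs_memE)
        then show "e \<in> {{v, w}}" using e \<open>v \<noteq> w\<close> by (auto simp: star_def)
      qed
      then have "card (star n v \<inter> star n w) \<le> card {{v, w}}" by (rule card_mono[rotated]) simp
      then have le1: "card (star n v \<inter> star n w) \<le> 1" by simp
      have "{E. star n v \<subseteq> E} \<inter> {E. star n w \<subseteq> E} = {E. star n v \<union> star n w \<subseteq> E}" by blast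
      then have "measure_pmf.prob ?M ({E. star n v \<subseteq> E} \<inter> {E. star n w \<subseteq> E}) =
          p ^ card (star n v \<union> star n w)"
        using prob_edges[OF p(3,4), of "star n v \<union> star n w" n] star by simp
      also have "\<dots> \<le> p ^ card (star n v) * p ^ card (star n w) / p ^ 1"
        by (rule power_card_Un[OF fin fin le1 p(1,4)])
      finally show "measure_pmf.prob ?M ({E. star n v \<subseteq> E} \<inter> {E. star n w \<subseteq> E}) \<le>
          (1 + (1 / p - 1)) * (measure_pmf.prob ?M {E. star n v \<subseteq> E} * measure_pmf.prob ?M {E. star n w \<subseteq> E})"
        by (simp add: prob_edges[OF p(3,4) star])
    qed simp
    also have "\<dots> \<le> 4 * (1 / (real n * p ^ n) + (1 / p - 1))"
      using \<mu>_ge pos by (intro mult_left_mono add_right_mono divide_left_mono) simp_all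
    finally have B1: "measure_pmf.prob ?M (?B1 n) \<le> 4 * (1 / (real n * p ^ n) + (1 / p - 1))" .
    have "card (vertex_pairs n) = n choose 2"
      unfolding vertex_pairs_def by (subst n_subsets) simp_all
    then have B2: "measure_pmf.prob ?M (?B2 n) = p powr (real n * (real n - 1) / 2)"
      using prob_edges[OF p(3,4) subset_refl, of n] p(1) real_choose_two[of n]
      by (metis powr_realpow)
    have "measure_pmf.prob ?M (?B n) \<le> measure_pmf.prob ?M (?B1 n) + measure_pmf.prob ?M (?B2 n)"
      by (rule measure_Un_le) simp_all
    then have "measure_pmf.prob ?M (?B n) \<le>
        4 * (1 / (real n * p ^ n) + (1 / p - 1)) + p powr (real n * (real n - 1) / 2)"
      using B1 B2 by linarith
    then show ?case unfolding p_eq by (simp only: p_def)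
  qed
  show "?e \<longlonglongrightarrow> 0" by real_asymp
qed

lemma whp_not_unmixed_dense_polynomial:
  assumes \<alpha>: "0 < \<alpha>" "\<alpha> < 2"
  shows "gnp_whp (\<lambda>n. 1 - real n powr (-\<alpha>))
    (\<lambda>n E. \<not> unmixed (mpoly_ring n) (edge_ideal n E :: 'k::field mpoly set))"
proof -
  consider "\<alpha> < 1" | "\<alpha> = 1" | "1 < \<alpha>" by linarith
  then show ?thesis
  proof cases
    case 1
    \<comment> \<open>The least integer with k\<alpha> > 1; then k\<alpha> \<le> 1 + \<alpha> <
      2.\<close>
    define k where "k = nat (\<lfloor>1 / \<alpha>\<rfloor> + 1)"
    have "real k = of_int (\<lfloor>1 / \<alpha>\<rfloor> + 1)" using \<alpha> by (simp add: k_def)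
    then have "1 / \<alpha> < real k" "real k \<le> 1 / \<alpha> + 1" by linarith+
    then have "1 < real k * \<alpha>" "real k * \<alpha> \<le> 1 + \<alpha>"
      using \<alpha> by (simp_all add: field_simps)
    then show ?thesis using 1 by (intro whp_not_unmixed_polynomial[of k]) simp_all
  next
    case 2
    then show ?thesis using whp_not_unmixed_one by simp
  next
    case 3
    then show ?thesis using \<alpha> by (intro whp_not_unmixed_polynomial[of 1]) simp_all
  qed
qed

theorem theorem1p4:
  shows
    "(\<forall>\<alpha>::real. 3/2 < \<alpha> \<and> \<alpha> < 2 \<longrightarrow>
        gnp_whp (\<lambda>n. real n powr (-\<alpha>))
          (\<lambda>n E. unmixed (mpoly_ring n) (edge_ideal n E :: 'k::field mpoly set)))
   \<and> (\<forall>\<alpha>::real. 1 \<le> \<alpha> \<and> \<alpha> < 3/2 \<longrightarrow>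
        gnp_whp (\<lambda>n. real n powr (-\<alpha>))
          (\<lambda>n E. \<not> unmixed (mpoly_ring n) (edge_ideal n E :: 'k mpoly set)))
   \<and> (\<forall>p::real. 0 < p \<and> p < 1 \<longrightarrow>
        gnp_whp (\<lambda>n. p)
          (\<lambda>n E. \<not> unmixed (mpoly_ring n) (edge_ideal n E :: 'k mpoly set)))
   \<and> (\<forall>\<alpha>::real. 0 < \<alpha> \<and> \<alpha> < 2 \<and> (\<forall>k::nat. k \<ge> 2 \<longrightarrow> inverse \<alpha> \<noteq> real k) \<longrightarrow>
        gnp_whp (\<lambda>n. 1 - real n powr (-\<alpha>))
          (\<lambda>n E. \<not> unmixed (mpoly_ring n) (edge_ideal n E :: 'k mpoly set)))
   \<and> (\<forall>\<alpha>::real. 2 < \<alpha> \<longrightarrow>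
        gnp_whp (\<lambda>n. 1 - real n powr (-\<alpha>))
          (\<lambda>n E. unmixed (mpoly_ring n) (edge_ideal n E :: 'k mpoly set)))"
  using whp_unmixed_very_sparse whp_not_unmixed_sparse whp_not_unmixed_constant
    whp_not_unmixed_dense_polynomial whp_unmixed_very_dense
  by blast

end
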